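(* Let $f(z_1,z_2)=(e^{z_1+z_2}+z_1,\;z_1+z_2)$ be defined on $\mathbb{D}^2$, the unit polydisc in $\mathbb{C}^2$. Then $f$ is a biholomorphism onto its image, $V=f(\mathbb{D}^2)$ is a quadrature domain, and if $\zeta=(\zeta_1,\zeta_2)$ is the coordinate on $V$, then every monomial of the form $\zeta_2^k$ ($k\ge 0$ an integer) is in the Bergman span of $V$, whereas for every integer $k>0$, $\zeta_1^k$ is not contained in the Bergman span of $V$.
   Context: $\mathbb{D}^2=\{(z_1,z_2)\in\mathbb{C}^2:|z_1|<1,|z_2|<1\}$. For a domain $\Omega\subset\mathbb{C}^n$, $H^2(\Omega)$ is the Bergman space of holomorphic functions on $\Omega$ square-integrable with respect to Lebesgue measure, and $K(z,w)$ is its Bergman kernel: holomorphic in $z$, antiholomorphic in $w$, with $\int_\Omega f(w)K(z,w)\,dV(w)=f(z)$ for all $f\in H^2(\Omega)$. The Bergman span of $\Omega$ is the complex linear span of the functions $z\mapsto\frac{\partial^\alpha}{\partial\bar w^\alpha}K(z,w)|_{w=w_0}$, where $\alpha$ ranges over multi-indices and $w_0$ ranges over $\Omega$. A domain $\Omega$ is a quadrature domain (for $H^2$ functions) if there exist finitely many points $z_i\in\Omega$ and constants $c_{i\alpha}$ with $\int_\Omega f\,dV=\sum_{i,\alpha}c_{i\alpha}\frac{\partial^\alpha f}{\partial z^\alpha}(z_i)$ for all $f\in H^2(\Omega)$ (for finite-volume domains, equivalently: the constant function $1$ is in the Bergman span). *)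

theory Defs
  imports "HOL-Complex_Analysis.Complex_Analysis"
begin

section \<open>Holomorphic functions and maps on subsets of \<open>\<complex>\<^sup>n\<close>\<close>

text \<open>Complex differentiability: the Frechet derivative exists and is complex linear. As the
  derivative is not restricted to \<open>S\<close>, this is meant for open \<open>S\<close>.\<close>

definition cn_holomorphic_on :: "(complex^'n \<Rightarrow> complex) \<Rightarrow> (complex^'n) set \<Rightarrow> bool"
    (infix \<open>cn'_holomorphic'_on\<close> 50) where
  "f cn_holomorphic_on S \<longleftrightarrow>
     (\<forall>z\<in>S. \<exists>c :: complex^'n. (f has_derivative (\<lambda>h. \<Sum>i\<in>UNIV. c $ i * h $ i)) (at z))"

definition biholomorphism ::
    "(complex^'n \<Rightarrow> complex^'m) \<Rightarrow> (complex^'n) set \<Rightarrow> (complex^'m) set \<Rightarrow> bool" where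
  "biholomorphism f U V \<longleftrightarrow> open U \<and> open V \<and> bij_betw f U V
     \<and> (\<forall>i. (\<lambda>z. f z $ i) cn_holomorphic_on U)
     \<and> (\<forall>i. (\<lambda>w. inv_into U f w $ i) cn_holomorphic_on V)"

definition is_domain :: "(complex^'n) set \<Rightarrow> bool" where
  "is_domain \<Omega> \<longleftrightarrow> open \<Omega> \<and> connected \<Omega> \<and> \<Omega> \<noteq> {}"

definition unit_polydisc :: "(complex^'n) set" where
  "unit_polydisc = {z. \<forall>i. norm (z $ i) < 1}"


section \<open>Partial derivatives\<close>

definition pd :: "'n \<Rightarrow> (complex^'n \<Rightarrow> complex) \<Rightarrow> complex^'n \<Rightarrow> complex" where
  "pd i f z = deriv (\<lambda>t. f (z + axis i t)) 0"

text \<open>The Wirtinger derivative \<open>\<partial>/\<partial>w\<^sub>i-bar = (\<partial>/\<partial>x\<^sub>i + \<i> \<partial>/\<partial>y\<^sub>i) / 2\<close>, where \<open>w\<^sub>i = x\<^sub>i + \<i> y\<^sub>i\<close>.\<close>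

definition pd_bar :: "'n \<Rightarrow> (complex^'n \<Rightarrow> complex) \<Rightarrow> complex^'n \<Rightarrow> complex" where
  "pd_bar i f w =
     (vector_derivative (\<lambda>t::real. f (w + axis i (of_real t))) (at 0)
      + \<i> * vector_derivative (\<lambda>t::real. f (w + axis i (\<i> * of_real t))) (at 0)) / 2"

text \<open>For a family \<open>D\<close> of partial derivative operators and a multi-index \<open>\<alpha>\<close>, the operator
  \<open>D\<^sup>\<alpha>\<close>. The linear order on the index type only fixes the order of differentiation, which is
  immaterial for (anti)holomorphic functions.\<close>

definition multi_pd ::
    "('n::{finite,linorder} \<Rightarrow> ((complex, 'n) vec \<Rightarrow> complex) \<Rightarrow> (complex, 'n) vec \<Rightarrow> complex)
     \<Rightarrow> ('n \<Rightarrow> nat) \<Rightarrow> ((complex, 'n) vec \<Rightarrow> complex) \<Rightarrow> (complex, 'n) vec \<Rightarrow> complex" where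
  "multi_pd D \<alpha> f = fold (\<lambda>i. D i ^^ \<alpha> i) (sorted_list_of_set UNIV) f"


section \<open>Bergman space, kernel and span; quadrature domains\<close>

definition bergman_space :: "(complex^'n) set \<Rightarrow> (complex^'n \<Rightarrow> complex) set" where
  "bergman_space \<Omega> =
     {f. f cn_holomorphic_on \<Omega> \<and> set_integrable lborel \<Omega> (\<lambda>z. (norm (f z))\<^sup>2)}"

text \<open>Antiholomorphy in the second variable is holomorphy of the conjugate. That
  \<open>\<lambda>w. cnj (K z w)\<close> is square integrable is part of the usual definition of the kernel (as the
  Riesz representative of evaluation at \<open>z\<close>); it makes the kernel unique.\<close>

definition is_bergman_kernel ::
    "(complex^'n) set \<Rightarrow> (complex^'n \<Rightarrow> complex^'n \<Rightarrow> complex) \<Rightarrow> bool" where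
  "is_bergman_kernel \<Omega> K \<longleftrightarrow>
     (\<forall>w\<in>\<Omega>. (\<lambda>z. K z w) cn_holomorphic_on \<Omega>)
     \<and> (\<forall>z\<in>\<Omega>. (\<lambda>w. cnj (K z w)) \<in> bergman_space \<Omega>)
     \<and> (\<forall>f\<in>bergman_space \<Omega>. \<forall>z\<in>\<Omega>. (LINT w:\<Omega>|lborel. f w * K z w) = f z)"

lemma is_bergman_kernel_unique:
  assumes K: "is_bergman_kernel \<Omega> K" and L: "is_bergman_kernel \<Omega> L"
    and z: "z \<in> \<Omega>" and u: "u \<in> \<Omega>"
  shows "K z u = L z u"
proof -
  have *: "K z u = cnj (L u z)"
    if K: "is_bergman_kernel \<Omega> K" and L: "is_bergman_kernel \<Omega> L" for K L
  proof -
    have repr: "(LINT w:\<Omega>|lborel. f w * M x w) = f x"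
      if "is_bergman_kernel \<Omega> M" "f \<in> bergman_space \<Omega>" "x \<in> \<Omega>" for f M x
      using that unfolding is_bergman_kernel_def by blast
    have mem: "(\<lambda>w. cnj (M x w)) \<in> bergman_space \<Omega>"
      if "is_bergman_kernel \<Omega> M" "x \<in> \<Omega>" for M x
      using that unfolding is_bergman_kernel_def by blast
    have "(LINT w:\<Omega>|lborel. cnj (L u w) * K z w) = cnj (L u z)"
      by (rule repr[OF K mem[OF L u] z])
    moreover have "(LINT w:\<Omega>|lborel. cnj (K z w) * L u w) = cnj (K z u)"
      by (rule repr[OF L mem[OF K z] u])
    then have "cnj (LINT w:\<Omega>|lborel. cnj (K z w) * L u w) = K z u"
      by simp
    moreover have "cnj (LINT w:\<Omega>|lborel. cnj (K z w) * L u w)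
        = (LINT w:\<Omega>|lborel. cnj (L u w) * K z w)"
      unfolding set_lebesgue_integral_def
      by (simp add: Bochner_Integration.integral_cnj [symmetric] mult.commute del: Bochner_Integration.integral_cnj)
    ultimately show ?thesis by simp
  qed
  show ?thesis using *[OF K L] *[OF L L] by simp
qed

text \<open>Only the values on \<open>\<Omega> \<times> \<Omega>\<close> are meaningful; these are determined by the lemma above.\<close>

definition bergman_kernel :: "(complex^'n) set \<Rightarrow> complex^'n \<Rightarrow> complex^'n \<Rightarrow> complex" where
  "bergman_kernel \<Omega> = (SOME K. is_bergman_kernel \<Omega> K)"

text \<open>Elements of the span are functions on \<open>\<Omega>\<close>, represented by total functions whose values
  outside \<open>\<Omega>\<close> are irrelevant.\<close>

definition bergman_span ::
    "(complex, 'n::{finite,linorder}) vec set \<Rightarrow> ((complex, 'n) vec \<Rightarrow> complex) set" where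
  "bergman_span \<Omega> = {g. \<exists>T c. finite T \<and> fst ` T \<subseteq> \<Omega> \<and>
     (\<forall>z\<in>\<Omega>. g z = (\<Sum>(w, \<alpha>)\<in>T. c w \<alpha> * multi_pd pd_bar \<alpha> (bergman_kernel \<Omega> z) w))}"

text \<open>Integrability of \<open>f\<close> is demanded because the Bochner integral of a nonintegrable function
  is 0 by convention.\<close>

definition quadrature_domain :: "(complex, 'n::{finite,linorder}) vec set \<Rightarrow> bool" where
  "quadrature_domain \<Omega> \<longleftrightarrow> is_domain \<Omega> \<and>
     (\<exists>T c. finite T \<and> fst ` T \<subseteq> \<Omega> \<and>
       (\<forall>f\<in>bergman_space \<Omega>. set_integrable lborel \<Omega> f \<and>
          (LINT z:\<Omega>|lborel. f z) = (\<Sum>(p, \<alpha>)\<in>T. c p \<alpha> * multi_pd pd \<alpha> f p)))"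

end

(*
  The map f is a composition of two shears, so it is measure preserving with inverse
  u(zeta) = (zeta_1 - exp zeta_2, zeta_2 - zeta_1 + exp zeta_2), and it carries the Bergman kernel
  of the bidisc to that of V; at zeta = f(0) the kernel is constant, which gives the quadrature
  identity.

  In the coordinates u the antiholomorphic derivatives of the kernel of V at f(0) are, up to lower
  order terms, arbitrary monomials in u_1, u_2 (the first order operators d/d zeta_j-bar and
  d/d u_j-bar differ by an invertible matrix with entries polynomial in the conjugate of exp zeta_2).
  Hence all polynomials in u, in particular the powers of zeta_2 = u_1 + u_2, are in the span.
  On the other hand every element of the span is a rational function of u, whereas on u_2 = 0 the
  function zeta_1^k is (exp u_1 + u_1)^k.

  The reproducing property of the disc follows by averaging over rotations: for |w| = r fixed,
  Cauchy's formula on the unit circle turns the average of h(w) / (1 - z cnj w)^2 into the derivative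
  of t h(t z) at t = r^2, and r^2 is uniformly distributed.
*)
theory Submission
  imports Defs
begin

section \<open>Measure preserving maps\<close>

text \<open>A shear preserves Lebesgue measure by Fubini and translation invariance alone, and
  rotations of the plane are reduced to shears as well.

  The obstacle on the kernel side is that the derivative in the conjugate of zeta_2 does not act
  with constant coefficients on the u-derivatives of the kernel: it produces factors exp of the
  conjugate of zeta_2. The computation therefore takes place among functions of both points, with a
  third index counting the powers of this factor. Two families are compared there: the u-derivatives
  times such powers and the zeta-derivatives times such powers. That the second lies in the span of
  the first makes every element of the Bergman span rational on the slice u_2 = 0. The converse puts
  the monomials into the Bergman span, because the factor is a mere number once the second point is
  fixed. At f(0), where u = 0, the u-derivatives are exactly constant multiples of monomials in u.

  For the negative half, a polynomial relation on the unit disc extends to the plane, and there the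
  exponential outgrows polynomials on the positive real axis.\<close>

lemma distr_lborel_shear_fst:
  fixes h :: "'b::euclidean_space \<Rightarrow> 'a::euclidean_space"
  assumes [measurable]: "h \<in> borel_measurable borel"
  shows "distr lborel borel (\<lambda>(x, y). (x + h y, y)) = lborel"
proof (rule measure_eqI)
  fix A :: "('a \<times> 'b) set"
  assume "A \<in> sets (distr lborel borel (\<lambda>(x, y). (x + h y, y)))"
  then have A: "A \<in> sets borel" by simp
  then have A' [measurable]: "A \<in> sets (lborel \<Otimes>\<^sub>M lborel)"
    unfolding lborel_prod by simp
  have m: "(\<lambda>(x, y). (x + h y, y)) \<in> measurable (borel :: ('a \<times> 'b) measure) borel"
    unfolding borel_prod [symmetric] by measurable
  have "emeasure (distr lborel borel (\<lambda>(x, y). (x + h y, y))) A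
      = (\<integral>\<^sup>+p. indicator A p \<partial>distr lborel borel (\<lambda>(x, y). (x + h y, y)))"
    using A by simp
  also have "\<dots> = (\<integral>\<^sup>+p. indicator A (case p of (x, y) \<Rightarrow> (x + h y, y)) \<partial>(lborel \<Otimes>\<^sub>M lborel))"
    using A m by (subst nn_integral_distr) (auto simp: lborel_prod)
  also have "\<dots> = (\<integral>\<^sup>+y. \<integral>\<^sup>+x. indicator A (x + h y, y) \<partial>lborel \<partial>lborel)"
    by (subst lborel_pair.nn_integral_snd [symmetric]) auto
  \<comment> \<open>For fixed \<open>y\<close> the shear is the translation of \<open>x\<close> by
    the constant \<open>h y\<close>.\<close>
  also have "\<dots> = (\<integral>\<^sup>+y. \<integral>\<^sup>+x. indicator A (x, y) \<partial>lborel \<partial>lborel)"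
  proof (rule nn_integral_cong)
    fix y
    have "(\<integral>\<^sup>+x. indicator A (x, y) \<partial>lborel) = (\<integral>\<^sup>+x. indicator A (x, y) \<partial>distr lborel borel ((+) (h y)))"
      by (simp add: lborel_distr_plus)
    also have "\<dots> = (\<integral>\<^sup>+x. indicator A (x + h y, y) \<partial>lborel)"
      using A' by (subst nn_integral_distr) (auto simp: add.commute)
    finally show "(\<integral>\<^sup>+x. indicator A (x + h y, y) \<partial>lborel) = (\<integral>\<^sup>+x. indicator A (x, y) \<partial>lborel)"
      by simp
  qed
  also have "\<dots> = (\<integral>\<^sup>+p. indicator A p \<partial>(lborel \<Otimes>\<^sub>M lborel))"
    by (subst lborel_pair.nn_integral_snd) auto
  also have "\<dots> = emeasure lborel A"
    using A by (simp add: lborel_prod)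
  finally show "emeasure (distr lborel borel (\<lambda>(x, y). (x + h y, y))) A = emeasure lborel A" .
qed simp

lemma distr_lborel_shear_snd:
  fixes h :: "'a::euclidean_space \<Rightarrow> 'b::euclidean_space"
  assumes [measurable]: "h \<in> borel_measurable borel"
  shows "distr lborel borel (\<lambda>(x, y). (x, y + h x)) = lborel"
proof (rule measure_eqI)
  fix A :: "('a \<times> 'b) set"
  assume "A \<in> sets (distr lborel borel (\<lambda>(x, y). (x, y + h x)))"
  then have A: "A \<in> sets borel" by simp
  then have A' [measurable]: "A \<in> sets (lborel \<Otimes>\<^sub>M lborel)"
    unfolding lborel_prod by simp
  have m: "(\<lambda>(x, y). (x, y + h x)) \<in> measurable (borel :: ('a \<times> 'b) measure) borel"
    unfolding borel_prod [symmetric] by measurable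
  have "emeasure (distr lborel borel (\<lambda>(x, y). (x, y + h x))) A
      = (\<integral>\<^sup>+p. indicator A p \<partial>distr lborel borel (\<lambda>(x, y). (x, y + h x)))"
    using A by simp
  also have "\<dots> = (\<integral>\<^sup>+p. indicator A (case p of (x, y) \<Rightarrow> (x, y + h x)) \<partial>(lborel \<Otimes>\<^sub>M lborel))"
    using A m by (subst nn_integral_distr) (auto simp: lborel_prod)
  also have "\<dots> = (\<integral>\<^sup>+x. \<integral>\<^sup>+y. indicator A (x, y + h x) \<partial>lborel \<partial>lborel)"
    by (subst lborel.nn_integral_fst [symmetric]) auto
  also have "\<dots> = (\<integral>\<^sup>+x. \<integral>\<^sup>+y. indicator A (x, y) \<partial>lborel \<partial>lborel)"
  proof (rule nn_integral_cong)
    fix x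
    have "(\<integral>\<^sup>+y. indicator A (x, y) \<partial>lborel) = (\<integral>\<^sup>+y. indicator A (x, y) \<partial>distr lborel borel ((+) (h x)))"
      by (simp add: lborel_distr_plus)
    also have "\<dots> = (\<integral>\<^sup>+y. indicator A (x, y + h x) \<partial>lborel)"
      using A' by (subst nn_integral_distr) (auto simp: add.commute)
    finally show "(\<integral>\<^sup>+y. indicator A (x, y + h x) \<partial>lborel) = (\<integral>\<^sup>+y. indicator A (x, y) \<partial>lborel)"
      by simp
  qed
  also have "\<dots> = (\<integral>\<^sup>+p. indicator A p \<partial>(lborel \<Otimes>\<^sub>M lborel))"
    by (subst lborel.nn_integral_fst) auto
  also have "\<dots> = emeasure lborel A"
    using A by (simp add: lborel_prod)
  finally show "emeasure (distr lborel borel (\<lambda>(x, y). (x, y + h x))) A = emeasure lborel A" .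
qed simp

lemma borel_measurable_vector_2:
  "(\<lambda>(x, y). vector [x, y] :: 'a::euclidean_space ^ 2) \<in> borel_measurable borel"
proof (rule borel_measurable_continuous_onI)
  have "(\<lambda>(x :: 'a, y :: 'a). vector [x, y] :: 'a ^ 2) = (\<lambda>p. \<chi> i. if i = 1 then fst p else snd p)"
    by (auto simp: vec_eq_iff forall_2)
  moreover have "continuous_on UNIV (\<lambda>p. if i = 1 then fst p else snd p :: 'a)" for i :: 2
    by (cases "i = 1") (auto intro!: continuous_intros)
  ultimately show "continuous_on UNIV (\<lambda>(x :: 'a, y :: 'a). vector [x, y] :: 'a ^ 2)"
    by (auto intro!: continuous_on_vec_lambda)
qed

text \<open>Lebesgue measure is determined by the volumes of boxes, and a box of vectors corresponds
  to a product of two boxes. This carries Fubini for pairs over to the vector type of the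
  theorem.\<close>

lemma distr_lborel_vector_2:
  "distr lborel borel (\<lambda>(x, y). vector [x, y]) = (lborel :: ('a::euclidean_space ^ 2) measure)"
proof (rule lborel_eqI [symmetric])
  fix l u :: "'a ^ 2"
  assume lu: "\<And>b. b \<in> Basis \<Longrightarrow> l \<bullet> b \<le> u \<bullet> b"
  have lu': "l $ i \<bullet> b \<le> u $ i \<bullet> b" if "b \<in> Basis" for i b
    using lu [of "axis i b"] that by (auto simp: inner_axis axis_in_Basis_iff)
  have eq: "(\<lambda>(x, y). vector [x, y]) -` box l u \<inter> space lborel = box (l $ 1) (u $ 1) \<times> box (l $ 2) (u $ 2)"
    by (auto simp: box_def Basis_vec_def inner_axis forall_2)
  have "emeasure (distr lborel borel (\<lambda>(x, y). vector [x, y])) (box l u)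
     = emeasure (lborel \<Otimes>\<^sub>M lborel) (box (l $ 1) (u $ 1) \<times> box (l $ 2) (u $ 2))"
    using borel_measurable_vector_2
    by (subst emeasure_distr) (simp_all only: eq lborel_prod measurable_lborel1 measurable_lborel2 sets_lborel borel_open open_box)
  also have "\<dots> = ennreal (\<Prod>b\<in>Basis. (u $ 1 - l $ 1) \<bullet> b) * ennreal (\<Prod>b\<in>Basis. (u $ 2 - l $ 2) \<bullet> b)"
    using lu' by (simp add: lborel.emeasure_pair_measure_Times)
  also have "\<dots> = ennreal (\<Prod>b\<in>Basis. (u - l) \<bullet> b)"
  proof -
    have "(\<Prod>b\<in>Basis. (u - l) \<bullet> b) = (\<Prod>i\<in>UNIV. \<Prod>b\<in>Basis. (u - l) \<bullet> axis i b)"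
      unfolding Basis_vec_def
      by (subst prod.UNION_disjoint) (auto simp: axis_eq_axis prod.UNION_disjoint)
    then show ?thesis
      using lu' by (simp add: inner_axis UNIV_2 ennreal_mult [symmetric] prod_nonneg inner_diff_left)
  qed
  finally show "emeasure (distr lborel borel (\<lambda>(x, y). vector [x, y])) (box l u) = ennreal (\<Prod>b\<in>Basis. (u - l) \<bullet> b)" .
qed simp

lemma distr_lborel_Complex:
  "distr lborel borel (\<lambda>(x, y). Complex x y) = lborel"
proof (rule lborel_eqI [symmetric])
  fix l u :: complex
  assume lu: "\<And>b. b \<in> Basis \<Longrightarrow> l \<bullet> b \<le> u \<bullet> b"
  have lu': "Re l \<le> Re u" "Im l \<le> Im u"
    using lu [of 1] lu [of "\<i>"] by (simp_all add: Basis_complex_def)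
  have cont: "continuous_on UNIV (\<lambda>(x, y). Complex x y)"
    by (auto simp: case_prod_unfold Complex_eq intro!: continuous_intros)
  have eq: "(\<lambda>(x, y). Complex x y) -` box l u \<inter> space lborel = box (Re l) (Re u) \<times> box (Im l) (Im u)"
    by (auto simp: box_def Basis_complex_def)
  have "emeasure (distr lborel borel (\<lambda>(x, y). Complex x y)) (box l u)
     = emeasure (lborel \<Otimes>\<^sub>M lborel) (box (Re l) (Re u) \<times> box (Im l) (Im u))"
    using borel_measurable_continuous_onI [OF cont]
    by (subst emeasure_distr) (simp_all only: eq lborel_prod measurable_lborel1 measurable_lborel2 sets_lborel borel_open open_box)
  also have "\<dots> = ennreal (Re u - Re l) * ennreal (Im u - Im l)"
    using lu' by (simp add: lborel.emeasure_pair_measure_Times)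
  also have "\<dots> = ennreal (\<Prod>b\<in>Basis. (u - l) \<bullet> b)"
    using lu' by (simp add: Basis_complex_def ennreal_mult [symmetric])
  finally show "emeasure (distr lborel borel (\<lambda>(x, y). Complex x y)) (box l u) = ennreal (\<Prod>b\<in>Basis. (u - l) \<bullet> b)" .
qed simp

lemma distr_lborel_compose:
  assumes "distr lborel borel g = lborel" "distr lborel borel f = lborel"
    and "g \<in> borel_measurable borel" "f \<in> borel_measurable borel"
  shows "distr lborel borel (\<lambda>x. g (f x)) = lborel"
proof -
  have "lborel = distr (distr lborel borel f) borel g"
    by (simp add: assms)
  also have "\<dots> = distr lborel borel (g \<circ> f)"
    by (rule distr_distr) (use assms in auto)
  finally show ?thesis by (simp add: o_def)
qed

text \<open>A rotation by an angle other than \<open>\<pi>\<close> is a product of three shears.\<close>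

lemma distr_lborel_rotation:
  fixes c :: complex
  assumes c: "norm c = 1"
  shows "distr lborel borel ((*) c) = lborel"
proof -
  have main: "distr lborel borel ((*) c) = lborel" if c: "norm c = 1" "c \<noteq> -1" for c :: complex
  proof -
    \<comment> \<open>With \<open>c\<close> at angle theta these are tan (theta / 2) and sin theta;
      the rotation is \<open>P\<close>, then \<open>Q\<close>, then \<open>P\<close> again. The
      half-angle tangent has its pole at theta = \<pi>, that is at \<open>c = -1\<close>.\<close>
    define t s where "t = Im c / (1 + Re c)" and "s = Im c"
    have cc: "(Re c)\<^sup>2 + (Im c)\<^sup>2 = 1"
      using c by (simp add: cmod_def)
    have ne: "1 + Re c \<noteq> 0"
    proof
      assume "1 + Re c = 0"
      then have "Re c = -1" by linarith
      with cc have "c = -1" by (simp add: complex_eq_iff)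
      with c show False by simp
    qed
    have ts: "1 - t * s = Re c" "2 * t - t * t * s = s"
    proof -
      show 1: "1 - t * s = Re c"
        using ne cc by (simp add: t_def s_def field_simps power2_eq_square)
      have "2 * t - t * t * s = t * (1 + (1 - t * s))"
        by (simp add: algebra_simps)
      also have "\<dots> = s"
        unfolding 1 using ne by (simp add: t_def s_def)
      finally show "2 * t - t * t * s = s" .
    qed
    define P where "P = (\<lambda>(x :: real, y :: real). (x + - t * y, y))"
    define Q where "Q = (\<lambda>(x :: real, y :: real). (x, y + s * x))"
    have P: "distr lborel borel P = lborel" "P \<in> borel_measurable borel"
      unfolding P_def
      subgoal by (rule distr_lborel_shear_fst) simp
      subgoal unfolding case_prod_unfold by (intro borel_measurable_continuous_onI continuous_intros)
      done
    have Q: "distr lborel borel Q = lborel" "Q \<in> borel_measurable borel"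
      unfolding Q_def
      subgoal by (rule distr_lborel_shear_snd) simp
      subgoal unfolding case_prod_unfold by (intro borel_measurable_continuous_onI continuous_intros)
      done
    define C where "C = (\<lambda>(x, y). Complex x y)"
    have C: "distr lborel borel C = lborel" "C \<in> borel_measurable borel"
      unfolding C_def
      subgoal by (rule distr_lborel_Complex)
      subgoal unfolding case_prod_unfold Complex_eq
        by (intro borel_measurable_continuous_onI continuous_intros)
      done
    note QP = distr_lborel_compose [OF Q(1) P(1) Q(2) P(2)] measurable_compose [OF P(2) Q(2)]
    note PQP = distr_lborel_compose [OF P(1) QP(1) P(2) QP(2)] measurable_compose [OF QP(2) P(2)]
    have "C (P (Q (P p))) = c * C p" for p
    proof (cases p)
      case (Pair x y)
      have "C (P (Q (P p))) = Complex ((1 - t * s) * x - (2 * t - t * t * s) * y) (s * x + (1 - t * s) * y)"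
        by (simp add: Pair C_def P_def Q_def algebra_simps)
      then show ?thesis
        unfolding ts by (simp add: Pair C_def complex_eq_iff s_def)
    qed
    then have "lborel = distr lborel borel (\<lambda>p. c * C p)"
      using distr_lborel_compose [OF C(1) PQP(1) C(2) PQP(2)] by simp
    also have "\<dots> = distr (distr lborel borel C) borel ((*) c)"
      using C by (subst distr_distr) (auto simp: o_def)
    finally show ?thesis using C by simp
  qed
  show ?thesis
  proof (cases "c = -1")
    case True
    \<comment> \<open>The excluded half turn is two quarter turns.\<close>
    have "distr lborel borel (\<lambda>x. \<i> * (\<i> * x)) = lborel"
      by (rule distr_lborel_compose [OF main main]) (auto simp: complex_eq_iff)
    moreover have "(\<lambda>x. \<i> * (\<i> * x)) = ((*) c)"
      using True by (auto simp: mult.assoc [symmetric])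
    ultimately show ?thesis by simp
  qed (use main c in auto)
qed

section \<open>The Bergman kernels of the disc and the bidisc\<close>

lemma emeasure_ball_complex: "emeasure lborel (ball (0 :: complex) r) = ennreal (pi * r\<^sup>2)" if "r \<ge> 0"
  using emeasure_ball [of r "0 :: complex"] that by (simp add: unit_ball_vol_2)

lemma emeasure_cball_complex: "emeasure lborel (cball (0 :: complex) r) = ennreal (pi * r\<^sup>2)" if "r \<ge> 0"
  using emeasure_cball [of r "0 :: complex"] that by (simp add: unit_ball_vol_2)

text \<open>The area \<open>pi * r\<^sup>2\<close> of a disc is linear in the squared radius, so
  both sides agree on all half-lines \<open>{x<..}\<close>, which determine the measure.\<close>

lemma distr_norm_power2_disc:
  "distr (density lborel (indicator (ball 0 1))) borel (\<lambda>w :: complex. (norm w)\<^sup>2)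
     = density lborel (\<lambda>t. ennreal pi * indicator {0..1} t)" (is "?M = ?N")
proof (rule measure_eqI_lessThan)
  fix x :: real
  have m: "(\<lambda>w :: complex. (norm w)\<^sup>2) \<in> borel_measurable (density lborel (indicator (ball 0 1)))"
    by measurable
  have M: "emeasure ?M {x<..} = emeasure lborel (ball 0 1 \<inter> {w :: complex. x < (norm w)\<^sup>2})"
  proof -
    have s: "{w :: complex. x < (norm w)\<^sup>2} \<in> sets borel"
      by measurable
    have "emeasure ?M {x<..} = emeasure (density lborel (indicator (ball 0 1))) {w :: complex. x < (norm w)\<^sup>2}"
      using m by (subst emeasure_distr) (auto simp: vimage_def)
    also have "\<dots> = (\<integral>\<^sup>+w. indicator (ball 0 1) w * indicator {w :: complex. x < (norm w)\<^sup>2} w \<partial>lborel)"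
      using s by (subst emeasure_density) (auto intro!: borel_measurable_indicator)
    also have "\<dots> = (\<integral>\<^sup>+w. indicator (ball 0 1 \<inter> {w :: complex. x < (norm w)\<^sup>2}) w \<partial>lborel)"
      by (simp add: indicator_inter_arith)
    finally show ?thesis using s by simp
  qed
  have N: "emeasure ?N {x<..} = ennreal pi * emeasure lborel ({0..1} \<inter> {x<..})"
  proof -
    have "emeasure ?N {x<..} = (\<integral>\<^sup>+t. ennreal pi * indicator {0..1} t * indicator {x<..} t \<partial>lborel)"
      by (subst emeasure_density) auto
    also have "\<dots> = (\<integral>\<^sup>+t. ennreal pi * indicator ({0..1} \<inter> {x<..}) t \<partial>lborel)"
      by (simp add: indicator_inter_arith mult.assoc)
    finally show ?thesis by (simp add: nn_integral_cmult)
  qed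
  show eq: "emeasure ?M {x<..} = emeasure ?N {x<..}"
  proof -
    consider "x < 0" | "0 \<le> x" "x < 1" | "1 \<le> x" by linarith
    then show ?thesis
    proof cases
      case 1
      then have "ball 0 1 \<inter> {w :: complex. x < (norm w)\<^sup>2} = ball 0 1"
        using order.strict_trans2 by fastforce
      moreover from 1 have "{0..1} \<inter> {x<..} = {0..1}"
        by auto
      ultimately show ?thesis
        unfolding M N using emeasure_ball_complex [of 1] by simp
    next
      case 2
      then have "x < (norm w)\<^sup>2 \<longleftrightarrow> sqrt x < norm w" for w :: complex
        using real_sqrt_less_iff [of x "(norm w)\<^sup>2"] by simp
      then have "{w :: complex. x < (norm w)\<^sup>2} = {w. sqrt x < norm w}"
        by simp
      then have "ball 0 1 \<inter> {w :: complex. x < (norm w)\<^sup>2} = ball 0 1 - cball 0 (sqrt x)"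
        by (auto simp: not_le)
      moreover have "cball (0 :: complex) (sqrt x) \<subseteq> ball 0 1"
        using 2 by (simp add: cball_subset_ball_iff)
      ultimately have "emeasure ?M {x<..} = ennreal (pi * 1\<^sup>2) - ennreal (pi * (sqrt x)\<^sup>2)"
        unfolding M using 2 emeasure_ball_complex [of 1] emeasure_cball_complex [of "sqrt x"]
        by (simp add: emeasure_Diff)
      also have "\<dots> = ennreal (pi * (1 - x))"
        using 2 by (simp add: ennreal_minus algebra_simps)
      also have "\<dots> = emeasure ?N {x<..}"
      proof -
        have "{0..1} \<inter> {x<..} = {x<..1}"
          using 2 by auto
        then show ?thesis
          unfolding N using 2 by (simp add: ennreal_mult)
      qed
      finally show ?thesis .
    next
      case 3
      have "(norm w)\<^sup>2 < 1" if "norm w < 1" for w :: complex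
        using that by (simp add: power_less_one_iff)
      with 3 have "ball 0 1 \<inter> {w :: complex. x < (norm w)\<^sup>2} = {}"
        by fastforce
      moreover from 3 have "{0..1} \<inter> {x<..} = {}"
        by auto
      ultimately show ?thesis
        unfolding M N by simp
    qed
  qed
  have "emeasure lborel ({0..1} \<inter> {x<..}) \<le> emeasure lborel {0..1 :: real}"
    by (intro emeasure_mono) auto
  then have "emeasure lborel ({0..1} \<inter> {x<..}) < \<infinity>"
    by (simp add: order.strict_trans1)
  then show "emeasure ?M {x<..} < \<infinity>"
    unfolding eq N by (simp add: ennreal_mult_less_top)
qed auto

lemma integral_disc_radial:
  fixes q :: "real \<Rightarrow> complex"
  assumes q: "continuous_on {0..1} q"
  shows "(LINT w:ball 0 1|lborel. q ((norm (w :: complex))\<^sup>2)) = pi * (LINT t:{0..1}|lborel. q t)"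
proof -
  define q' where "q' = (\<lambda>t. indicator {0..1} t *\<^sub>R q t)"
  have q' [measurable]: "q' \<in> borel_measurable borel"
    unfolding q'_def using q by (intro borel_measurable_continuous_on_indicator) auto
  have "(LINT w:ball 0 1|lborel. q ((norm (w :: complex))\<^sup>2))
      = (LINT w|lborel. indicator (ball 0 1) w *\<^sub>R q' ((norm (w :: complex))\<^sup>2))"
    unfolding set_lebesgue_integral_def q'_def
    by (intro Bochner_Integration.integral_cong) (auto simp: indicator_def power_le_one)
  also have "\<dots> = (LINT w|density lborel (\<lambda>w. ennreal (indicator (ball 0 1) w)). q' ((norm (w :: complex))\<^sup>2))"
    by (subst integral_density) (auto intro!: borel_measurable_indicator)
  also have "\<dots> = (LINT t|distr (density lborel (indicator (ball 0 1))) borel (\<lambda>w :: complex. (norm w)\<^sup>2). q' t)"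
    by (subst integral_distr) (auto simp: ennreal_indicator)
  also have "\<dots> = (LINT t|density lborel (\<lambda>t. ennreal (pi * indicator {0..1} t)). q' t)"
    unfolding distr_norm_power2_disc by (simp add: ennreal_mult ennreal_indicator)
  also have "\<dots> = (LINT t|lborel. (pi * indicator {0..1} t) *\<^sub>R q' t)"
    by (subst integral_density) auto
  also have "\<dots> = (LINT t|lborel. pi * (indicator {0..1} t *\<^sub>R q t))"
    unfolding q'_def by (intro Bochner_Integration.integral_cong) (auto simp: indicator_def scaleR_conv_of_real)
  also have "\<dots> = pi * (LINT t:{0..1}|lborel. q t)"
    unfolding set_lebesgue_integral_def by (simp only: mult_scaleR_right [symmetric] integral_mult_right_zero)
  finally show ?thesis .
qed

text \<open>Each rotation leaves the integral over the disc unchanged, so the integral equals its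
  mean over all angles, and Fubini moves the mean inside. Integrability on the product holds because
  the integral of \<open>norm (\<Phi> (e t * w))\<close> over \<open>w\<close> is the same for every
  \<open>t\<close>.\<close>

lemma integral_disc_rotation_average:
  fixes \<phi> :: "complex \<Rightarrow> complex"
  assumes \<phi>: "continuous_on (ball 0 1) \<phi>" "set_integrable lborel (ball 0 1) \<phi>"
  shows "(LINT w:ball 0 1|lborel. \<phi> w)
    = (LINT w:ball 0 1|lborel. LINT t:{0..1}|lborel. \<phi> (circlepath 0 1 t * w))"
proof -
  define e where "e = circlepath 0 1"
  have e: "norm (e t) = 1" for t
    by (simp add: e_def circlepath)
  have e_meas [measurable]: "e \<in> borel_measurable borel"
    unfolding e_def circlepath by (intro borel_measurable_continuous_onI continuous_intros)
  define \<Phi> where "\<Phi> = (\<lambda>w. indicator (ball 0 1) w *\<^sub>R \<phi> w)"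
  have \<Phi>_meas [measurable]: "\<Phi> \<in> borel_measurable borel"
    unfolding \<Phi>_def using \<phi>(1) by (intro borel_measurable_continuous_on_indicator) auto
  have \<Phi>_int: "integrable lborel \<Phi>"
    using \<phi>(2) by (simp add: set_integrable_def \<Phi>_def)
  have mc: "(*) (e t) \<in> borel_measurable lborel" for t
    by simp
  have rot_int: "integrable lborel (\<lambda>w. \<Phi> (e t * w))" for t
    using \<Phi>_int integrable_distr [OF mc [of t], of \<Phi>] distr_lborel_rotation [OF e [of t]]
    by simp
  have rot: "(LINT w|lborel. g (e t * w)) = integral\<^sup>L lborel g"
    if [measurable]: "g \<in> borel_measurable borel" for t and g :: "complex \<Rightarrow> 'b::{banach, second_countable_topology}"
    using integral_distr [OF mc [of t], of g] distr_lborel_rotation [OF e [of t]]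
    by simp
  define f where "f = (\<lambda>t w. indicator {0..1 :: real} t *\<^sub>R \<Phi> (e t * w))"
  have int01: "integrable lborel (\<lambda>t. indicator {0..1 :: real} t *\<^sub>R c)" for c :: "'b::{banach, second_countable_topology}"
    by (intro integrable_indicator) auto
  have f_int: "integrable (lborel \<Otimes>\<^sub>M lborel) (\<lambda>(t, w). f t w)"
  proof (rule lborel_pair.Fubini_integrable)
    show "(\<lambda>(t, w). f t w) \<in> borel_measurable (lborel \<Otimes>\<^sub>M lborel)"
      unfolding f_def by measurable
    have "(LINT w|lborel. norm (f t w)) = indicator {0..1} t *\<^sub>R (LINT w|lborel. norm (\<Phi> w))" for t
      using rot [of "\<lambda>w. norm (\<Phi> w)" t] by (auto simp: f_def indicator_def)
    then show "integrable lborel (\<lambda>t. LINT w|lborel. norm (case (t, w) of (t, w) \<Rightarrow> f t w))"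
      using int01 [of "LINT w|lborel. norm (\<Phi> w)"] by simp
    show "AE t in lborel. integrable lborel (\<lambda>w. case (t, w) of (t, w) \<Rightarrow> f t w)"
      using rot_int by (simp add: f_def)
  qed
  have "(LINT w:ball 0 1|lborel. LINT t:{0..1}|lborel. \<phi> (e t * w)) = (LINT w|lborel. LINT t|lborel. f t w)"
    unfolding set_lebesgue_integral_def f_def \<Phi>_def
    by (intro Bochner_Integration.integral_cong) (auto simp: indicator_def norm_mult e)
  also have "\<dots> = (LINT t|lborel. LINT w|lborel. f t w)"
    by (rule lborel_pair.Fubini_integral [OF f_int])
  also have "\<dots> = (LINT t|lborel. indicator {0..1 :: real} t *\<^sub>R (LINT w|lborel. \<Phi> w))"
  proof -
    have "(LINT w|lborel. f t w) = indicator {0..1} t *\<^sub>R (LINT w|lborel. \<Phi> w)" for t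
      using rot [of \<Phi> t] \<Phi>_meas by (auto simp: f_def indicator_def)
    then show ?thesis by (simp only:)
  qed
  also have "\<dots> = (LINT w|lborel. \<Phi> w)"
    by (subst integral_scaleR_left) auto
  finally show ?thesis
    by (simp add: e_def \<Phi>_def set_lebesgue_integral_def)
qed

section \<open>Reproducing formulas for the disc and the bidisc\<close>

lemma one_minus_mult_nonzero: "1 - z * cnj w \<noteq> 0" if "norm z < 1" "norm w < 1" for z w :: complex
proof
  assume "1 - z * cnj w = 0"
  then have "norm (z * cnj w) = 1" by simp
  moreover have "norm z * norm w < 1"
    using that by (metis mult_strict_mono' norm_ge_zero mult_1)
  ultimately show False by (simp add: norm_mult)
qed

text \<open>On the unit circle \<open>cnj c = 1 / c\<close>, which turns the antiholomorphic kernel into a Cauchy kernel.\<close>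

lemma circle_average_kernel:
  fixes h :: "complex \<Rightarrow> complex" and z w :: complex
  assumes h: "h holomorphic_on ball 0 1" and z: "norm z < 1" and w: "norm w < 1"
  defines "a \<equiv> (norm w)\<^sup>2 * z"
  shows "(LINT t:{0..1}|lborel. h (circlepath 0 1 t * w) / (1 - z * cnj (circlepath 0 1 t * w))\<^sup>2)
    = h a + a * deriv h a"
proof -
  define e where "e = circlepath 0 1"
  have e: "norm (e t) = 1" "e t \<noteq> 0" for t
    by (auto simp: e_def circlepath)
  have ec: "cnj (e t) = 1 / e t" for t
    using e(1) [of t] e(2) [of t] complex_norm_square [of "e t"] by (simp add: field_simps)
  have et: "e t = exp (2 * of_real pi * \<i> * of_real t)" for t
    by (simp add: e_def circlepath)
  have e': "vector_derivative e (at t within {0..1}) = 2 * of_real pi * \<i> * e t" if "t \<in> {0..1}" for t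
    using vector_derivative_circlepath01 [of t 0 1] that by (simp add: et e_def [symmetric])
  have e_cont: "continuous_on A e" for A
    unfolding e_def circlepath by (intro continuous_intros)
  define b where "b = z * cnj w"
  have wb: "w * b = a"
    unfolding a_def b_def using complex_norm_square [of w] by (simp add: mult_ac)
  have b: "norm b < 1"
    unfolding b_def norm_mult using z w by (metis mult_strict_mono' norm_ge_zero mult_1 complex_mod_cnj)
  have a: "norm a < 1"
    unfolding wb [symmetric] norm_mult using w b by (metis mult_strict_mono' norm_ge_zero mult_1)
  have wc: "c * w \<in> ball 0 1" if "norm c \<le> 1" for c
    using that w by (auto simp: norm_mult intro: le_less_trans [OF mult_left_le_one_le])
  \<comment> \<open>On the unit circle \<open>cnj c = 1 / c\<close> gives \<open>1 / (1 - z * cnj (c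
    * w))\<^sup>2 = c\<^sup>2 / (c - b)\<^sup>2\<close>. One factor \<open>c\<close> is used up by
    \<open>dc = 2 * pi * \<i> * c * dt\<close>, the other stays in \<open>G\<close>. The double pole
    \<open>b\<close> lies inside the circle, and \<open>w * b = a\<close> makes the derivative of
    \<open>G\<close> at \<open>b\<close> the claimed value.\<close>
  define G where "G = (\<lambda>c. c * h (c * w))"
  have G_hol: "G holomorphic_on cball 0 1"
    unfolding G_def using wc
    by (intro holomorphic_intros holomorphic_on_compose_gen [OF _ h, unfolded o_def]) auto
  have "(h has_field_derivative deriv h a) (at a)"
    using h a by (intro holomorphic_derivI) auto
  then have "((\<lambda>c. h (c * w)) has_field_derivative deriv h a * w) (at b)"
    unfolding wb [symmetric] mult.commute [of w b]
    by (rule DERIV_chain2) (auto intro!: derivative_eq_intros)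
  then have G': "(G has_field_derivative h a + a * deriv h a) (at b)"
    unfolding G_def wb [symmetric]
    by (auto intro!: derivative_eq_intros simp: mult_ac)
  let ?K = "\<lambda>c. G c / (c - b)\<^sup>2"
  have Gc: "continuous_on (cball 0 1) G" "G holomorphic_on ball 0 1" "b \<in> ball 0 1"
    using G_hol b by (auto intro: holomorphic_on_imp_continuous_on holomorphic_on_subset)
  note C = Cauchy_derivative_integral_circlepath [OF Gc]
  have "contour_integral e ?K = 2 * pi * \<i> * (h a + a * deriv h a)"
    using DERIV_unique [OF C(2) G'] by (simp add: e_def field_simps)
  then have "(?K has_contour_integral 2 * pi * \<i> * (h a + a * deriv h a)) e"
    using C(1) has_contour_integral_integral unfolding e_def by metis
  then have "((\<lambda>t. ?K (e t) * (2 * pi * \<i> * e t)) has_integral 2 * pi * \<i> * (h a + a * deriv h a)) {0..1}"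
    unfolding has_contour_integral_def
    by (rule has_integral_eq [rotated])
       (simp add: e')
  moreover have "?K (e t) * (2 * pi * \<i> * e t) = 2 * pi * \<i> * (h (e t * w) / (1 - z * cnj (e t * w))\<^sup>2)" for t
  proof -
    have "1 - z * cnj (e t * w) = (e t - b) / e t"
      using e(2) [of t] by (simp add: b_def ec field_simps)
    moreover have "e t - b \<noteq> 0"
      using e(1) [of t] b by auto
    ultimately show ?thesis
      using e(2) [of t] by (simp add: G_def power_divide power2_eq_square)
  qed
  ultimately have "((\<lambda>t. 2 * pi * \<i> * (h (e t * w) / (1 - z * cnj (e t * w))\<^sup>2))
      has_integral 2 * pi * \<i> * (h a + a * deriv h a)) {0..1}"
    by simp
  from has_integral_mult_right [OF this, of "1 / (2 * pi * \<i>)"]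
  have I: "((\<lambda>t. h (e t * w) / (1 - z * cnj (e t * w))\<^sup>2) has_integral h a + a * deriv h a) {0..1}"
    by simp
  have cont: "continuous_on {0..1} (\<lambda>t. h (e t * w) / (1 - z * cnj (e t * w))\<^sup>2)"
    using wc e(1) one_minus_mult_nonzero [OF z]
    by (intro continuous_intros e_cont continuous_on_compose2 [OF holomorphic_on_imp_continuous_on [OF h]])
       (auto simp del: complex_cnj_mult)
  have "set_integrable lborel {0..1} (\<lambda>t. h (e t * w) / (1 - z * cnj (e t * w))\<^sup>2)"
    unfolding set_integrable_def using cont by (intro borel_integrable_compact) auto
  from set_borel_integral_eq_integral(2) [OF this] integral_unique [OF I]
  show ?thesis unfolding e_def by simp
qed

text \<open>For fixed \<open>z\<close> the kernel is bounded in \<open>w\<close>, so multiplying by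
  it preserves integrability.\<close>

lemma norm_kernel_le:
  fixes z w :: complex
  assumes z: "norm z < 1" and w: "norm w < 1"
  shows "norm (1 / (1 - z * cnj w)\<^sup>2) \<le> 1 / (1 - norm z)\<^sup>2"
proof -
  have "norm (z * cnj w) \<le> norm z"
    using w by (simp add: norm_mult mult_left_le)
  then have "1 - norm z \<le> norm (1 - z * cnj w)"
    using norm_triangle_ineq2 [of 1 "z * cnj w"] by simp
  then have "(1 - norm z)\<^sup>2 \<le> (norm (1 - z * cnj w))\<^sup>2"
    using z by (intro power_mono) auto
  then have "1 / (norm (1 - z * cnj w))\<^sup>2 \<le> 1 / (1 - norm z)\<^sup>2"
    using z by (intro divide_left_mono mult_pos_pos) (auto intro: order.strict_trans2)
  then show ?thesis
    by (simp add: norm_divide norm_power)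
qed

lemma set_integrable_disc_kernel:
  fixes h :: "complex \<Rightarrow> complex"
  assumes "h holomorphic_on ball 0 1" and int: "set_integrable lborel (ball 0 1) h" and z: "norm z < 1"
  shows "set_integrable lborel (ball 0 1) (\<lambda>w. h w / (1 - z * cnj w)\<^sup>2)"
proof -
  have cont: "continuous_on (ball 0 1) (\<lambda>w. h w / (1 - z * cnj w)\<^sup>2)"
    using one_minus_mult_nonzero [OF z] assms(1)
    by (intro continuous_intros holomorphic_on_imp_continuous_on) auto
  have bound: "norm (h w / (1 - z * cnj w)\<^sup>2) \<le> 1 / (1 - norm z)\<^sup>2 * norm (h w)" if "w \<in> ball 0 1" for w
    using mult_right_mono [OF norm_kernel_le [OF z, of w], of "norm (h w)"] that
    by (simp add: norm_divide)
  have int': "set_integrable lborel (ball 0 1) (\<lambda>w. 1 / (1 - norm z)\<^sup>2 * norm (h w))"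
    using int by (intro set_integrable_mult_right set_integrable_norm) auto
  have meas: "set_borel_measurable lborel (ball 0 1) (\<lambda>w. h w / (1 - z * cnj w)\<^sup>2)"
    unfolding set_borel_measurable_def
    using borel_measurable_continuous_on_indicator [OF _ cont] by simp
  have "AE w in lborel. w \<in> ball 0 1 \<longrightarrow>
      norm (h w / (1 - z * cnj w)\<^sup>2) \<le> norm (1 / (1 - norm z)\<^sup>2 * norm (h w))"
    using order.trans [OF bound abs_ge_self] by (intro AE_I2 impI) (simp only: real_norm_def)
  then show ?thesis
    by (rule set_integrable_bound [OF int' meas])
qed

text \<open>The hypothesis is integrability rather than square integrability, which is the property
  that Fubini hands to the slices of a function on the bidisc.\<close>

lemma disc_reproducing:
  fixes h :: "complex \<Rightarrow> complex"
  assumes h: "h holomorphic_on ball 0 1" "set_integrable lborel (ball 0 1) h" and z: "norm z < 1"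
  shows "(LINT w:ball 0 1|lborel. h w / (1 - z * cnj w)\<^sup>2) = pi * h z"
proof -
  have tz: "norm (complex_of_real t * z) < 1" if "t \<in> {0..1}" for t
    using that z by (auto simp: norm_mult intro: le_less_trans [OF mult_left_le_one_le])
  define q where "q = (\<lambda>t :: real. h (t * z) + t * z * deriv h (t * z))"
  have q: "continuous_on {0..1} q"
    unfolding q_def using tz
    by (intro continuous_intros continuous_on_compose2 [OF holomorphic_on_imp_continuous_on [OF h(1)]]
          continuous_on_compose2 [OF holomorphic_on_imp_continuous_on [OF holomorphic_deriv [OF h(1)]]]) auto
  have cont: "continuous_on (ball 0 1) (\<lambda>w. h w / (1 - z * cnj w)\<^sup>2)"
    using one_minus_mult_nonzero [OF z] h(1)
    by (intro continuous_intros holomorphic_on_imp_continuous_on) auto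
  have "((\<lambda>t. of_real t * h (of_real t * z)) has_vector_derivative q t) (at t within {0..1})" if "t \<in> {0..1}" for t
  proof -
    have h': "(h has_field_derivative deriv h (t * z)) (at (t * z))"
      using h(1) tz [OF that] by (intro holomorphic_derivI) auto
    have "((\<lambda>s. s * h (s * z)) has_field_derivative q t) (at (of_real t))"
      unfolding q_def
      by (rule derivative_eq_intros DERIV_chain2 [where g = "\<lambda>s. s * z", OF h'] refl)+ (simp add: algebra_simps)
    from has_vector_derivative_real_field [OF this]
    show ?thesis by (simp add: has_vector_derivative_at_within)
  qed
  from has_bochner_integral_FTC_Icc [OF _ this q]
  have "has_bochner_integral lborel (\<lambda>t. indicator {0..1} t *\<^sub>R q t) (h z)"
    by simp
  then have q_int: "(LINT t:{0..1}|lborel. q t) = h z"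
    unfolding set_lebesgue_integral_def by (rule has_bochner_integral_integral_eq)
  have "(LINT w:ball 0 1|lborel. h w / (1 - z * cnj w)\<^sup>2)
      = (LINT w:ball 0 1|lborel. q ((norm (w :: complex))\<^sup>2))"
    unfolding integral_disc_rotation_average [OF cont set_integrable_disc_kernel [OF h z]]
    by (rule set_lebesgue_integral_cong)
       (use circle_average_kernel [OF h(1) z] in \<open>auto simp: q_def\<close>)
  then show ?thesis
    unfolding integral_disc_radial [OF q] q_int by simp
qed

text \<open>The kernel is a product, so the disc formula applies in the first variable for almost
  every \<open>y\<close> and then in the second.\<close>

lemma bidisc_reproducing:
  fixes g :: "complex \<times> complex \<Rightarrow> complex"
  assumes hol1: "\<And>y. norm y < 1 \<Longrightarrow> (\<lambda>x. g (x, y)) holomorphic_on ball 0 1"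
    and hol2: "\<And>x. norm x < 1 \<Longrightarrow> (\<lambda>y. g (x, y)) holomorphic_on ball 0 1"
    and int: "set_integrable lborel (ball 0 1 \<times> ball 0 1) g"
    and z: "norm z1 < 1" "norm z2 < 1"
  shows "(LINT p:ball 0 1 \<times> ball 0 1|lborel. g p * (1 / (1 - z1 * cnj (fst p))\<^sup>2 * (1 / (1 - z2 * cnj (snd p))\<^sup>2)))
    = pi\<^sup>2 * g (z1, z2)"
proof -
  let ?D = "ball (0 :: complex) 1"
  define k where "k = (\<lambda>z w. 1 / (1 - z * cnj w)\<^sup>2)"
  have k_meas [measurable]: "k z \<in> borel_measurable borel" for z
    unfolding k_def by (intro borel_measurable_divide borel_measurable_continuous_onI continuous_intros)
  have k_le: "norm (k z w) \<le> 1 / (1 - norm z)\<^sup>2" if "norm z < 1" "norm w < 1" for z w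
    unfolding k_def using that by (rule norm_kernel_le)
  define G where "G = (\<lambda>x y. indicator (?D \<times> ?D) (x, y) *\<^sub>R g (x, y))"
  have G0: "G x y = 0" if "\<not> (norm x < 1 \<and> norm y < 1)" for x y
    using that by (auto simp: G_def)
  have G_int: "integrable (lborel \<Otimes>\<^sub>M lborel) (\<lambda>(x, y). G x y)"
    using int unfolding set_integrable_def lborel_prod G_def by (simp add: case_prod_unfold)
  have G_meas [measurable]: "(\<lambda>(x, y). G x y) \<in> borel_measurable (lborel \<Otimes>\<^sub>M lborel)"
    using borel_measurable_integrable [OF G_int] .
  have G_bound: "integrable (lborel \<Otimes>\<^sub>M lborel) (\<lambda>(x, y). G x y * c x y)"
    if c [measurable]: "(\<lambda>(x, y). c x y) \<in> borel_measurable (lborel \<Otimes>\<^sub>M lborel)"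
      and B: "\<And>x y. norm x < 1 \<Longrightarrow> norm y < 1 \<Longrightarrow> norm (c x y) \<le> B" for c :: "complex \<Rightarrow> complex \<Rightarrow> complex" and B :: real
  proof (rule Bochner_Integration.integrable_bound)
    show "integrable (lborel \<Otimes>\<^sub>M lborel) (\<lambda>(x, y). of_real B * G x y)"
      using G_int by (auto simp: case_prod_unfold)
    show "(\<lambda>(x, y). G x y * c x y) \<in> borel_measurable (lborel \<Otimes>\<^sub>M lborel)"
      using borel_measurable_times [OF G_meas c] by (simp add: case_prod_unfold)
    have "norm (G x y * c x y) \<le> norm (of_real B * G x y)" for x y
    proof (cases "norm x < 1 \<and> norm y < 1")
      case True
      with B have "norm (c x y) \<le> \<bar>B\<bar>"
        by (meson abs_ge_self order_trans)
      then show ?thesis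
        by (simp add: norm_mult mult.commute [of "\<bar>B\<bar>"] mult_left_mono)
    qed (simp add: G0)
    then show "AE p in lborel \<Otimes>\<^sub>M lborel. norm (case p of (x, y) \<Rightarrow> G x y * c x y)
        \<le> norm (case p of (x, y) \<Rightarrow> of_real B * G x y)"
      by (auto simp: case_prod_unfold)
  qed
  have G1_int: "integrable (lborel \<Otimes>\<^sub>M lborel) (\<lambda>(x, y). G x y * k z1 x)"
    by (rule G_bound [of _ "1 / (1 - norm z1)\<^sup>2"]) (use k_le z in auto)
  have G2_int: "integrable (lborel \<Otimes>\<^sub>M lborel) (\<lambda>(x, y). G x y * (k z1 x * k z2 y))"
  proof (rule G_bound [of _ "1 / (1 - norm z1)\<^sup>2 * (1 / (1 - norm z2)\<^sup>2)"])
    show "norm (k z1 x * k z2 y) \<le> 1 / (1 - norm z1)\<^sup>2 * (1 / (1 - norm z2)\<^sup>2)"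
      if "norm x < 1" "norm y < 1" for x y
      unfolding norm_mult using that z k_le by (intro mult_mono) auto
  qed measurable
  have gz1: "continuous_on ?D (\<lambda>y. g (z1, y))"
    using hol2 [OF z(1)] by (rule holomorphic_on_imp_continuous_on)
  have gz1_meas: "(\<lambda>y. indicator ?D y *\<^sub>R (pi * g (z1, y))) \<in> borel_measurable borel"
    using gz1 by (intro borel_measurable_continuous_on_indicator continuous_intros) auto
  have fst_int: "AE y in lborel. (LINT x|lborel. G x y * k z1 x) = indicator ?D y *\<^sub>R (pi * g (z1, y))"
    using lborel_pair.AE_integrable_snd [OF G_int]
  proof eventually_elim
    case (elim y)
    show ?case
    proof (cases "norm y < 1")
      case True
      have "set_integrable lborel ?D (\<lambda>x. g (x, y))"
        using elim True unfolding set_integrable_def G_def by (simp add: indicator_times)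
      from disc_reproducing [OF hol1 [OF True] this z(1)] True show ?thesis
        by (simp add: set_lebesgue_integral_def G_def k_def indicator_times scaleR_conv_of_real)
    qed (simp add: G0)
  qed
  \<comment> \<open>Fubini gives integrable slices only for almost every \<open>x\<close>, which
    says nothing about the single slice \<open>x = z1\<close>. But the inner integral, weighted by
    the kernel, is \<open>pi * g (z1, y)\<close> almost everywhere, and Fubini does make that inner
    integral integrable.\<close>
  have "integrable lborel (\<lambda>y. LINT x|lborel. G x y * k z1 x)"
    using lborel_pair.integrable_snd [OF G1_int] .
  then have "integrable lborel (\<lambda>y. indicator ?D y *\<^sub>R (pi * g (z1, y)))"
    using fst_int gz1_meas by (rule_tac integrable_cong_AE_imp) (auto elim: eventually_mono)
  then have "integrable lborel (\<lambda>y. 1 / pi * (indicator ?D y *\<^sub>R (pi * g (z1, y))))"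
    by (rule integrable_mult_right)
  then have gz1_int: "set_integrable lborel ?D (\<lambda>y. g (z1, y))"
    by (simp add: set_integrable_def)
  have "(LINT p:?D \<times> ?D|lborel. g p * (1 / (1 - z1 * cnj (fst p))\<^sup>2 * (1 / (1 - z2 * cnj (snd p))\<^sup>2)))
      = integral\<^sup>L (lborel \<Otimes>\<^sub>M lborel) (\<lambda>(x, y). G x y * (k z1 x * k z2 y))"
    unfolding set_lebesgue_integral_def lborel_prod G_def k_def
    by (intro Bochner_Integration.integral_cong) (auto simp: case_prod_unfold scaleR_conv_of_real)
  also have "\<dots> = (LINT y|lborel. LINT x|lborel. G x y * (k z1 x * k z2 y))"
    by (rule lborel_pair.integral_snd [OF G2_int, symmetric])
  also have "\<dots> = (LINT y|lborel. (LINT x|lborel. G x y * k z1 x) * k z2 y)"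
    by (simp add: mult.assoc [symmetric])
  also have "\<dots> = (LINT y|lborel. (indicator ?D y *\<^sub>R (pi * g (z1, y))) * k z2 y)"
  proof (rule integral_cong_AE)
    show "(\<lambda>y. (LINT x|lborel. G x y * k z1 x) * k z2 y) \<in> borel_measurable lborel"
      using borel_measurable_integrable [OF lborel_pair.integrable_snd [OF G1_int]]
      by (intro borel_measurable_times) auto
    show "(\<lambda>y. indicator ?D y *\<^sub>R (pi * g (z1, y)) * k z2 y) \<in> borel_measurable lborel"
      using gz1_meas by (intro borel_measurable_times) auto
    show "AE y in lborel. (LINT x|lborel. G x y * k z1 x) * k z2 y = indicator ?D y *\<^sub>R (pi * g (z1, y)) * k z2 y"
      using fst_int by eventually_elim simp
  qed
  also have "\<dots> = (LINT y|lborel. pi * (indicator ?D y *\<^sub>R (g (z1, y) / (1 - z2 * cnj y)\<^sup>2)))"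
    by (simp add: k_def scaleR_conv_of_real mult_ac)
  also have "\<dots> = pi * (LINT y:?D|lborel. g (z1, y) / (1 - z2 * cnj y)\<^sup>2)"
    unfolding set_lebesgue_integral_def by (rule integral_mult_right_zero)
  also have "\<dots> = pi\<^sup>2 * g (z1, z2)"
    unfolding disc_reproducing [OF hol2 [OF z(1)] gz1_int z(2)] by (simp add: power2_eq_square)
  finally show ?thesis .
qed

section \<open>Complex differentiable functions of several variables\<close>

lemma cn_holomorphic_on_const: "(\<lambda>_. a) cn_holomorphic_on S"
  unfolding cn_holomorphic_on_def by (intro ballI exI [of _ 0]) auto

lemma cn_holomorphic_on_nth: "(\<lambda>z :: complex^'n. z $ i) cn_holomorphic_on S"
  unfolding cn_holomorphic_on_def
proof
  fix z :: "complex^'n"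
  have "((\<lambda>z. z $ i) has_derivative (\<lambda>h. h $ i)) (at z)"
    by (rule bounded_linear.has_derivative [OF bounded_linear_vec_nth]) auto
  moreover have "(\<Sum>j\<in>UNIV. axis i 1 $ j * h $ j) = h $ i" for h :: "complex^'n"
    by (subst sum.remove [of _ i]) (auto simp: axis_def)
  ultimately show "\<exists>c. ((\<lambda>z. z $ i) has_derivative (\<lambda>h. \<Sum>j\<in>UNIV. c $ j * h $ j)) (at z)"
    by (intro exI [of _ "axis i 1"]) simp
qed

lemma cn_holomorphic_on_add:
  assumes "f cn_holomorphic_on S" "g cn_holomorphic_on S"
  shows "(\<lambda>z. f z + g z) cn_holomorphic_on S"
  unfolding cn_holomorphic_on_def
proof
  fix z assume "z \<in> S"
  then obtain c d where "(f has_derivative (\<lambda>h. \<Sum>i\<in>UNIV. c $ i * h $ i)) (at z)"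
    "(g has_derivative (\<lambda>h. \<Sum>i\<in>UNIV. d $ i * h $ i)) (at z)"
    using assms unfolding cn_holomorphic_on_def by blast
  from has_derivative_add [OF this]
  show "\<exists>c. ((\<lambda>z. f z + g z) has_derivative (\<lambda>h. \<Sum>j\<in>UNIV. c $ j * h $ j)) (at z)"
    by (intro exI [of _ "c + d"]) (simp add: ring_distribs sum.distrib)
qed

lemma cn_holomorphic_on_mult:
  assumes "f cn_holomorphic_on S" "g cn_holomorphic_on S"
  shows "(\<lambda>z. f z * g z) cn_holomorphic_on S"
  unfolding cn_holomorphic_on_def
proof
  fix z assume "z \<in> S"
  then obtain c d where "(f has_derivative (\<lambda>h. \<Sum>i\<in>UNIV. c $ i * h $ i)) (at z)"
    "(g has_derivative (\<lambda>h. \<Sum>i\<in>UNIV. d $ i * h $ i)) (at z)"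
    using assms unfolding cn_holomorphic_on_def by blast
  from has_derivative_mult [OF this]
  show "\<exists>c. ((\<lambda>z. f z * g z) has_derivative (\<lambda>h. \<Sum>j\<in>UNIV. c $ j * h $ j)) (at z)"
    by (intro exI [of _ "\<chi> i. f z * d $ i + c $ i * g z"])
       (simp add: ring_distribs sum.distrib sum_distrib_left sum_distrib_right mult_ac)
qed

lemma cn_holomorphic_on_compose:
  assumes "f cn_holomorphic_on S" "\<And>z. z \<in> S \<Longrightarrow> \<phi> field_differentiable at (f z)"
  shows "(\<lambda>z. \<phi> (f z)) cn_holomorphic_on S"
  unfolding cn_holomorphic_on_def
proof
  fix z assume z: "z \<in> S"
  then obtain c where c: "(f has_derivative (\<lambda>h. \<Sum>i\<in>UNIV. c $ i * h $ i)) (at z)"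
    using assms unfolding cn_holomorphic_on_def by blast
  obtain d where d: "(\<phi> has_field_derivative d) (at (f z))"
    using assms(2) [OF z] unfolding field_differentiable_def by blast
  from has_derivative_compose [OF c d [unfolded has_field_derivative_def]]
  show "\<exists>c. ((\<lambda>z. \<phi> (f z)) has_derivative (\<lambda>h. \<Sum>j\<in>UNIV. c $ j * h $ j)) (at z)"
    by (intro exI [of _ "\<chi> i. d * c $ i"]) (simp add: sum_distrib_left mult_ac)
qed

lemma cn_holomorphic_on_diff:
  assumes "f cn_holomorphic_on S" "g cn_holomorphic_on S"
  shows "(\<lambda>z. f z - g z) cn_holomorphic_on S"
  using cn_holomorphic_on_add [OF assms(1) cn_holomorphic_on_mult [OF cn_holomorphic_on_const [of "-1"] assms(2)]]
  by simp

lemma cn_holomorphic_on_exp: "f cn_holomorphic_on S \<Longrightarrow> (\<lambda>z. exp (f z)) cn_holomorphic_on S"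
  by (rule cn_holomorphic_on_compose) (auto simp: field_differentiable_within_exp)

lemma cn_holomorphic_on_inverse:
  "f cn_holomorphic_on S \<Longrightarrow> (\<And>z. z \<in> S \<Longrightarrow> f z \<noteq> 0) \<Longrightarrow> (\<lambda>z. inverse (f z)) cn_holomorphic_on S"
  by (rule cn_holomorphic_on_compose) (auto intro!: derivative_intros)

lemma cn_holomorphic_on_power: "f cn_holomorphic_on S \<Longrightarrow> (\<lambda>z. f z ^ n) cn_holomorphic_on S"
  by (induction n) (auto intro: cn_holomorphic_on_const cn_holomorphic_on_mult)

named_theorems cn_holomorphic_intros
lemmas [cn_holomorphic_intros] =
  cn_holomorphic_on_const cn_holomorphic_on_nth cn_holomorphic_on_add cn_holomorphic_on_diff
  cn_holomorphic_on_mult cn_holomorphic_on_exp cn_holomorphic_on_inverse cn_holomorphic_on_power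

lemma cn_holomorphic_on_imp_continuous_on: "f cn_holomorphic_on S \<Longrightarrow> continuous_on S f"
  unfolding cn_holomorphic_on_def
  by (meson continuous_at_imp_continuous_on has_derivative_continuous)

lemma cn_holomorphic_on_cong:
  assumes "open S" "\<And>z. z \<in> S \<Longrightarrow> f z = g z"
  shows "f cn_holomorphic_on S \<longleftrightarrow> g cn_holomorphic_on S"
  unfolding cn_holomorphic_on_def
  using assms has_derivative_transform_within_open [of _ _ _ UNIV S] by (smt (verit, best) ball_cong)

lemma has_derivative_vec:
  fixes f :: "'a::real_normed_vector \<Rightarrow> 'b::euclidean_space ^ 'n"
  assumes "\<And>i. ((\<lambda>x. f x $ i) has_derivative (\<lambda>h. f' h $ i)) (at a within S)"
  shows "(f has_derivative f') (at a within S)"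
  unfolding has_derivative_componentwise_within [of f]
  using assms by (auto simp: Basis_vec_def inner_axis intro: has_derivative_inner_left)

text \<open>Applied to the images of coordinate lines under \<open>shear_exp\<close>, this yields
  the separate holomorphy that \<open>bidisc_reproducing\<close> asks for.\<close>

lemma cn_holomorphic_on_compose_curve:
  fixes \<gamma> :: "complex \<Rightarrow> complex^'n"
  assumes f: "f cn_holomorphic_on S" and "\<gamma> t \<in> S"
    and \<gamma>: "\<And>i. ((\<lambda>t. \<gamma> t $ i) has_field_derivative d i) (at t)"
  shows "(\<lambda>t. f (\<gamma> t)) field_differentiable at t"
proof -
  obtain c where c: "(f has_derivative (\<lambda>h. \<Sum>i\<in>UNIV. c $ i * h $ i)) (at (\<gamma> t))"
    using assms(1,2) unfolding cn_holomorphic_on_def by blast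
  have "(\<gamma> has_derivative (\<lambda>h. \<chi> i. d i * h)) (at t)"
    using \<gamma> unfolding has_field_derivative_def by (intro has_derivative_vec) simp
  from has_derivative_compose [OF this c]
  have "((\<lambda>t. f (\<gamma> t)) has_derivative (\<lambda>h. \<Sum>i\<in>UNIV. c $ i * (d i * h))) (at t)"
    by simp
  moreover have "(\<lambda>h. \<Sum>i\<in>UNIV. c $ i * (d i * h)) = (*) (\<Sum>i\<in>UNIV. c $ i * d i)"
    by (simp add: fun_eq_iff sum_distrib_right mult.assoc)
  ultimately have "((\<lambda>t. f (\<gamma> t)) has_field_derivative (\<Sum>i\<in>UNIV. c $ i * d i)) (at t)"
    unfolding has_field_derivative_def by simp
  then show ?thesis
    unfolding field_differentiable_def by blast
qed

section \<open>The Bergman kernel of the image domain\<close>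

text \<open>The map of the theorem, taken on pairs instead of vectors so that Fubini for product
  measures applies.\<close>

definition shear_exp :: "complex \<times> complex \<Rightarrow> complex ^ 2" where
  "shear_exp p = vector [exp (fst p + snd p) + fst p, fst p + snd p]"

definition u1 :: "complex ^ 2 \<Rightarrow> complex" where "u1 \<zeta> = \<zeta> $ 1 - exp (\<zeta> $ 2)"
definition u2 :: "complex ^ 2 \<Rightarrow> complex" where "u2 \<zeta> = \<zeta> $ 2 - \<zeta> $ 1 + exp (\<zeta> $ 2)"

text \<open>The image of the bidisc described through the inverse map, so that it is open by
  continuity of \<open>u1\<close> and \<open>u2\<close>.\<close>

definition exp_domain :: "(complex ^ 2) set" where
  "exp_domain = {\<zeta>. norm (u1 \<zeta>) < 1 \<and> norm (u2 \<zeta>) < 1}"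

text \<open>The kernel of the bidisc in the coordinates u. The transformation rule contributes no
  further factor because the Jacobian determinant of the map is 1.\<close>

definition exp_kernel :: "complex ^ 2 \<Rightarrow> complex ^ 2 \<Rightarrow> complex" where
  "exp_kernel \<zeta> \<eta> = 1 / pi\<^sup>2 * (1 / (1 - u1 \<zeta> * cnj (u1 \<eta>))\<^sup>2 * (1 / (1 - u2 \<zeta> * cnj (u2 \<eta>))\<^sup>2))"

lemma u_shear_exp [simp]: "u1 (shear_exp p) = fst p" "u2 (shear_exp p) = snd p"
  by (simp_all add: u1_def u2_def shear_exp_def)

lemma shear_exp_u [simp]: "shear_exp (u1 \<zeta>, u2 \<zeta>) = \<zeta>"
  by (simp add: u1_def u2_def shear_exp_def vec_eq_iff forall_2)

lemma shear_exp_in_exp_domain [simp]: "shear_exp p \<in> exp_domain \<longleftrightarrow> p \<in> ball 0 1 \<times> ball 0 1"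
  by (cases p) (simp add: exp_domain_def)

lemma u_cn_holomorphic [cn_holomorphic_intros]: "u1 cn_holomorphic_on S" "u2 cn_holomorphic_on S"
  unfolding u1_def u2_def by (intro cn_holomorphic_intros)+

lemma continuous_on_u: "continuous_on S u1" "continuous_on S u2"
  by (intro cn_holomorphic_on_imp_continuous_on cn_holomorphic_intros)+

lemma open_exp_domain: "open exp_domain"
  unfolding exp_domain_def
  by (intro open_Collect_conj open_Collect_less continuous_intros continuous_on_u)

lemma continuous_on_shear_exp: "continuous_on S shear_exp"
proof -
  have eq: "shear_exp = (\<lambda>p. \<chi> i. if i = 1 then exp (fst p + snd p) + fst p else fst p + snd p)"
    by (auto simp: vec_eq_iff forall_2 shear_exp_def)
  have "continuous_on S (\<lambda>p. if i = 1 then exp (fst p + snd p) + fst p else fst p + snd p :: complex)"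
    for i :: 2
    by (cases "i = 1") (auto intro!: continuous_intros)
  then show ?thesis
    unfolding eq by (intro continuous_on_vec_lambda)
qed

lemma shear_exp_measurable [measurable]: "shear_exp \<in> borel_measurable borel"
  by (intro borel_measurable_continuous_onI continuous_on_shear_exp)

lemma distr_lborel_shear_exp: "distr lborel borel shear_exp = lborel"
proof -
  define A where "A = (\<lambda>(x :: complex, y :: complex). (x, y + x))"
  define B where "B = (\<lambda>(x :: complex, y :: complex). (x + exp y, y))"
  define C where "C = (\<lambda>(x :: complex, y :: complex). vector [x, y] :: complex ^ 2)"
  have A: "distr lborel borel A = lborel" "A \<in> borel_measurable borel"
    unfolding A_def
    subgoal by (rule distr_lborel_shear_snd) simp
    subgoal unfolding case_prod_unfold by (intro borel_measurable_continuous_onI continuous_intros)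
    done
  have B: "distr lborel borel B = lborel" "B \<in> borel_measurable borel"
    unfolding B_def
    subgoal by (rule distr_lborel_shear_fst) (intro borel_measurable_continuous_onI continuous_intros)
    subgoal unfolding case_prod_unfold by (intro borel_measurable_continuous_onI continuous_intros)
    done
  have C: "distr lborel borel C = lborel" "C \<in> borel_measurable borel"
    unfolding C_def
    subgoal by (rule distr_lborel_vector_2)
    subgoal by (rule borel_measurable_vector_2)
    done
  have "shear_exp = (\<lambda>p. C (B (A p)))"
    by (auto simp: shear_exp_def A_def B_def C_def add_ac)
  then show ?thesis
    using distr_lborel_compose [OF C(1) distr_lborel_compose [OF B(1) A(1) B(2) A(2)] C(2)
        measurable_compose [OF A(2) B(2)]] by simp
qed

lemma set_integral_exp_domain:
  fixes \<phi> :: "complex ^ 2 \<Rightarrow> complex"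
  assumes "continuous_on exp_domain \<phi>"
  shows "(LINT \<zeta>:exp_domain|lborel. \<phi> \<zeta>) = (LINT p:ball 0 1 \<times> ball 0 1|lborel. \<phi> (shear_exp p))"
    and "set_integrable lborel exp_domain \<phi> \<longleftrightarrow> set_integrable lborel (ball 0 1 \<times> ball 0 1) (\<lambda>p. \<phi> (shear_exp p))"
proof -
  have m: "(\<lambda>\<zeta>. indicator exp_domain \<zeta> *\<^sub>R \<phi> \<zeta>) \<in> borel_measurable borel"
    using assms open_exp_domain by (intro borel_measurable_continuous_on_indicator) auto
  have eq: "indicator exp_domain (shear_exp p) = (indicator (ball 0 1 \<times> ball 0 1) p :: real)" for p
    by (simp add: indicator_def)
  show "(LINT \<zeta>:exp_domain|lborel. \<phi> \<zeta>) = (LINT p:ball 0 1 \<times> ball 0 1|lborel. \<phi> (shear_exp p))"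
    using integral_distr [of shear_exp lborel borel, OF _ m]
    by (simp add: distr_lborel_shear_exp set_lebesgue_integral_def eq)
  show "set_integrable lborel exp_domain \<phi> \<longleftrightarrow> set_integrable lborel (ball 0 1 \<times> ball 0 1) (\<lambda>p. \<phi> (shear_exp p))"
    using integrable_distr_eq [of shear_exp lborel borel, OF _ m]
    by (simp add: distr_lborel_shear_exp set_integrable_def eq)
qed

lemma emeasure_exp_domain: "emeasure lborel exp_domain < \<infinity>"
proof -
  have "emeasure lborel exp_domain = emeasure (distr lborel borel shear_exp) exp_domain"
    by (simp add: distr_lborel_shear_exp)
  also have "\<dots> = emeasure lborel (shear_exp -` exp_domain)"
    using open_exp_domain by (subst emeasure_distr) auto
  also have "shear_exp -` exp_domain = ball 0 1 \<times> ball 0 1"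
    by auto
  also have "emeasure lborel (ball 0 1 \<times> ball 0 1 :: (complex \<times> complex) set) < \<infinity>"
    by (intro emeasure_bounded_finite bounded_Times) auto
  finally show ?thesis .
qed

text \<open>Finite volume turns square integrability into the integrability that
  \<open>quadrature_domain\<close> and \<open>bidisc_reproducing\<close> demand.\<close>

lemma bergman_space_imp_set_integrable:
  fixes f :: "complex^'n \<Rightarrow> complex"
  assumes f: "f \<in> bergman_space \<Omega>" and \<Omega>: "open \<Omega>" "emeasure lborel \<Omega> < \<infinity>"
  shows "set_integrable lborel \<Omega> f"
proof (rule set_integrable_bound)
  have "continuous_on \<Omega> f"
    using f by (auto simp: bergman_space_def intro: cn_holomorphic_on_imp_continuous_on)
  then show "set_borel_measurable lborel \<Omega> f"
    using borel_measurable_continuous_on_indicator [of \<Omega> f] \<Omega>(1)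
    by (simp add: set_borel_measurable_def)
  have "set_integrable lborel \<Omega> (\<lambda>_. 1 :: real)"
    unfolding set_integrable_def using \<Omega> by (intro integrable_indicator) auto
  then show "set_integrable lborel \<Omega> (\<lambda>z. 1 + (norm (f z))\<^sup>2)"
    using f by (intro set_integral_add) (auto simp: bergman_space_def)
  have "norm (f z) \<le> norm (1 + (norm (f z))\<^sup>2)" for z
  proof -
    \<comment> \<open>The right-hand side is \<open>2 * (1 + n\<^sup>2 - n)\<close> for
      \<open>n = norm (f z)\<close>.\<close>
    have "0 \<le> (norm (f z) - 1)\<^sup>2 + (norm (f z))\<^sup>2 + 1" by simp
    then have "norm (f z) \<le> 1 + (norm (f z))\<^sup>2"
      by (simp add: power2_eq_square algebra_simps)
    then show ?thesis by simp
  qed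
  then show "AE z in lborel. z \<in> \<Omega> \<longrightarrow> norm (f z) \<le> norm (1 + (norm (f z))\<^sup>2)"
    by simp
qed

lemma shear_exp_slice_has_derivative:
  "((\<lambda>x. shear_exp (x, y) $ i) has_field_derivative (if i = 1 then exp (x + y) + 1 else 1)) (at x)"
  "((\<lambda>y. shear_exp (x, y) $ i) has_field_derivative (if i = 1 then exp (x + y) else 1)) (at y)"
proof -
  have "i = 1 \<or> i = 2"
    by (rule exhaust_2)
  then show "((\<lambda>x. shear_exp (x, y) $ i) has_field_derivative (if i = 1 then exp (x + y) + 1 else 1)) (at x)"
    "((\<lambda>y. shear_exp (x, y) $ i) has_field_derivative (if i = 1 then exp (x + y) else 1)) (at y)"
    by (auto simp: shear_exp_def intro!: derivative_eq_intros)
qed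

lemma holomorphic_on_shear_exp_slice:
  assumes f: "f cn_holomorphic_on exp_domain"
  shows "norm y < 1 \<Longrightarrow> (\<lambda>x. f (shear_exp (x, y))) holomorphic_on ball 0 1"
    and "norm x < 1 \<Longrightarrow> (\<lambda>y. f (shear_exp (x, y))) holomorphic_on ball 0 1"
  unfolding holomorphic_on_def
  by (auto intro!: field_differentiable_at_within cn_holomorphic_on_compose_curve [OF f _ shear_exp_slice_has_derivative(1)]
      cn_holomorphic_on_compose_curve [OF f _ shear_exp_slice_has_derivative(2)])

lemma one_minus_u_nonzero:
  assumes "\<zeta> \<in> exp_domain" "\<eta> \<in> exp_domain"
  shows "1 - u1 \<zeta> * cnj (u1 \<eta>) \<noteq> 0" "1 - u2 \<zeta> * cnj (u2 \<eta>) \<noteq> 0"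
  using assms one_minus_mult_nonzero [of "u1 \<zeta>" "u1 \<eta>"] one_minus_mult_nonzero [of "u2 \<zeta>" "u2 \<eta>"]
  by (auto simp: exp_domain_def)

lemma exp_kernel_cnj: "cnj (exp_kernel \<zeta> \<eta>) = exp_kernel \<eta> \<zeta>"
  by (simp add: exp_kernel_def mult.commute)

lemma exp_kernel_holomorphic:
  assumes "\<eta> \<in> exp_domain"
  shows "(\<lambda>\<zeta>. exp_kernel \<zeta> \<eta>) cn_holomorphic_on exp_domain"
  unfolding exp_kernel_def divide_inverse
  using one_minus_u_nonzero [OF _ assms] by (intro cn_holomorphic_intros) auto

lemma norm_exp_kernel_le:
  assumes "\<zeta> \<in> exp_domain" "\<eta> \<in> exp_domain"
  shows "norm (exp_kernel \<zeta> \<eta>) \<le> 1 / pi\<^sup>2 * (1 / (1 - norm (u1 \<zeta>))\<^sup>2 * (1 / (1 - norm (u2 \<zeta>))\<^sup>2))"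
proof -
  have "norm (1 / (1 - u1 \<zeta> * cnj (u1 \<eta>))\<^sup>2) \<le> 1 / (1 - norm (u1 \<zeta>))\<^sup>2"
    "norm (1 / (1 - u2 \<zeta> * cnj (u2 \<eta>))\<^sup>2) \<le> 1 / (1 - norm (u2 \<zeta>))\<^sup>2"
    using assms by (auto simp: exp_domain_def intro!: norm_kernel_le simp del: norm_divide)
  note le = this
  have "norm (exp_kernel \<zeta> \<eta>) = 1 / pi\<^sup>2 *
      (norm (1 / (1 - u1 \<zeta> * cnj (u1 \<eta>))\<^sup>2) * norm (1 / (1 - u2 \<zeta> * cnj (u2 \<eta>))\<^sup>2))"
    by (simp add: exp_kernel_def norm_mult norm_divide norm_power)
  also have "\<dots> \<le> 1 / pi\<^sup>2 * (1 / (1 - norm (u1 \<zeta>))\<^sup>2 * (1 / (1 - norm (u2 \<zeta>))\<^sup>2))"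
    by (intro mult_left_mono mult_mono le) auto
  finally show ?thesis .
qed

lemma is_bergman_kernel_exp_kernel: "is_bergman_kernel exp_domain exp_kernel"
  unfolding is_bergman_kernel_def
proof (intro conjI ballI)
  fix \<eta> assume "\<eta> \<in> exp_domain"
  then show "(\<lambda>\<zeta>. exp_kernel \<zeta> \<eta>) cn_holomorphic_on exp_domain"
    by (rule exp_kernel_holomorphic)
next
  fix \<zeta> assume \<zeta>: "\<zeta> \<in> exp_domain"
  have cont: "continuous_on exp_domain (\<lambda>\<eta>. exp_kernel \<eta> \<zeta>)"
    by (rule cn_holomorphic_on_imp_continuous_on [OF exp_kernel_holomorphic [OF \<zeta>]])
  define M where "M = 1 / pi\<^sup>2 * (1 / (1 - norm (u1 \<zeta>))\<^sup>2 * (1 / (1 - norm (u2 \<zeta>))\<^sup>2))"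
  have "norm (exp_kernel \<eta> \<zeta>) \<le> M" if "\<eta> \<in> exp_domain" for \<eta>
    using norm_exp_kernel_le [OF \<zeta> that] by (simp add: M_def exp_kernel_cnj [of \<zeta> \<eta>, symmetric])
  then have bound: "(norm (exp_kernel \<eta> \<zeta>))\<^sup>2 \<le> M\<^sup>2" if "\<eta> \<in> exp_domain" for \<eta>
    using that by (intro power_mono) auto
  have "set_integrable lborel exp_domain (\<lambda>\<eta>. (norm (exp_kernel \<eta> \<zeta>))\<^sup>2)"
    unfolding set_integrable_def
  proof (rule integrableI_bounded_set)
    show "(\<lambda>\<eta>. indicator exp_domain \<eta> *\<^sub>R (norm (exp_kernel \<eta> \<zeta>))\<^sup>2) \<in> borel_measurable lborel"
      using borel_measurable_continuous_on_indicator [of exp_domain "\<lambda>\<eta>. (norm (exp_kernel \<eta> \<zeta>))\<^sup>2"]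
        cont open_exp_domain by (simp add: continuous_intros)
    show "AE \<eta> in lborel. \<eta> \<in> exp_domain \<longrightarrow> norm (indicator exp_domain \<eta> *\<^sub>R (norm (exp_kernel \<eta> \<zeta>))\<^sup>2) \<le> M\<^sup>2"
      using bound by (intro AE_I2) simp
  qed (use open_exp_domain emeasure_exp_domain in auto)
  then show "(\<lambda>\<eta>. cnj (exp_kernel \<zeta> \<eta>)) \<in> bergman_space exp_domain"
    unfolding exp_kernel_cnj by (simp add: bergman_space_def exp_kernel_holomorphic [OF \<zeta>])
next
  fix f \<zeta> assume f: "f \<in> bergman_space exp_domain" and \<zeta>: "\<zeta> \<in> exp_domain"
  have hol: "f cn_holomorphic_on exp_domain"
    using f by (simp add: bergman_space_def)
  have "continuous_on exp_domain (\<lambda>\<eta>. cnj (exp_kernel \<eta> \<zeta>))"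
    by (intro continuous_on_cnj cn_holomorphic_on_imp_continuous_on [OF exp_kernel_holomorphic [OF \<zeta>]])
  then have cont: "continuous_on exp_domain (\<lambda>\<eta>. f \<eta> * exp_kernel \<zeta> \<eta>)"
    unfolding exp_kernel_cnj by (intro continuous_on_mult cn_holomorphic_on_imp_continuous_on [OF hol])
  have int: "set_integrable lborel (ball 0 1 \<times> ball 0 1) (\<lambda>p. f (shear_exp p))"
    using bergman_space_imp_set_integrable [OF f open_exp_domain emeasure_exp_domain]
      set_integral_exp_domain(2) [OF cn_holomorphic_on_imp_continuous_on [OF hol]] by simp
  have "(LINT \<eta>:exp_domain|lborel. f \<eta> * exp_kernel \<zeta> \<eta>)
    = (LINT p:ball 0 1 \<times> ball 0 1|lborel. 1 / pi\<^sup>2 * (f (shear_exp p) *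
        (1 / (1 - u1 \<zeta> * cnj (fst p))\<^sup>2 * (1 / (1 - u2 \<zeta> * cnj (snd p))\<^sup>2))))"
    unfolding set_integral_exp_domain(1) [OF cont]
    by (simp add: exp_kernel_def mult_ac)
  also have "\<dots> = 1 / pi\<^sup>2 * (LINT p:ball 0 1 \<times> ball 0 1|lborel. f (shear_exp p) *
        (1 / (1 - u1 \<zeta> * cnj (fst p))\<^sup>2 * (1 / (1 - u2 \<zeta> * cnj (snd p))\<^sup>2)))"
    by (rule set_integral_mult_right)
  also have "\<dots> = f \<zeta>"
    using \<zeta> by (subst bidisc_reproducing [OF holomorphic_on_shear_exp_slice [OF hol] int])
      (auto simp: exp_domain_def)
  finally show "(LINT \<eta>:exp_domain|lborel. f \<eta> * exp_kernel \<zeta> \<eta>) = f \<zeta>" .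
qed

text \<open>\<open>bergman_kernel\<close> is defined by choice: \<open>exp_kernel\<close> witnesses
  that a kernel exists, and uniqueness identifies the chosen one with it on the domain.\<close>

lemma bergman_kernel_exp_domain:
  assumes "\<zeta> \<in> exp_domain" "\<eta> \<in> exp_domain"
  shows "bergman_kernel exp_domain \<zeta> \<eta> = exp_kernel \<zeta> \<eta>"
  using is_bergman_kernel_unique [OF _ is_bergman_kernel_exp_kernel assms]
    someI [of "is_bergman_kernel exp_domain", OF is_bergman_kernel_exp_kernel]
  unfolding bergman_kernel_def by blast

lemma quadrature_domain_exp_domain: "quadrature_domain exp_domain"
proof -
  let ?o = "shear_exp 0"
  have o: "?o \<in> exp_domain"
    by (simp add: zero_prod_def)
  have "exp_domain = shear_exp ` (ball 0 1 \<times> ball 0 1)"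
  proof (intro equalityI subsetI)
    fix \<zeta> assume "\<zeta> \<in> exp_domain"
    then show "\<zeta> \<in> shear_exp ` (ball 0 1 \<times> ball 0 1)"
      by (intro image_eqI [of _ _ "(u1 \<zeta>, u2 \<zeta>)"]) (auto simp: exp_domain_def)
  qed auto
  then have "connected exp_domain"
    by (metis connected_continuous_image continuous_on_shear_exp connected_Times connected_ball)
  then have dom: "is_domain exp_domain"
    unfolding is_domain_def using open_exp_domain o by blast
  \<comment> \<open>The single weight \<open>pi\<^sup>2\<close> is the volume of the domain, as the
    constant function 1 shows.\<close>
  have "(LINT \<zeta>:exp_domain|lborel. f \<zeta>) = pi\<^sup>2 * f ?o" if f: "f \<in> bergman_space exp_domain" for f :: "complex ^ 2 \<Rightarrow> complex"
  proof -
    have "f ?o = (LINT \<eta>:exp_domain|lborel. f \<eta> * exp_kernel ?o \<eta>)"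
      using is_bergman_kernel_exp_kernel f o unfolding is_bergman_kernel_def by simp
    also have "\<dots> = (LINT \<eta>:exp_domain|lborel. f \<eta> * (1 / pi\<^sup>2))"
      by (simp add: exp_kernel_def)
    also have "\<dots> = (LINT \<eta>:exp_domain|lborel. f \<eta>) * (1 / pi\<^sup>2)"
      by (rule set_integral_mult_left)
    finally show ?thesis by simp
  qed
  moreover have "multi_pd pd (\<lambda>_. 0) f p = f p" for f and p :: "complex ^ 2"
  proof -
    have "fold (\<lambda>i. pd i ^^ 0) xs f = f" for xs :: "2 list"
      by (induction xs) auto
    then show ?thesis by (simp add: multi_pd_def)
  qed
  ultimately show ?thesis
    unfolding quadrature_domain_def
    using dom o bergman_space_imp_set_integrable [OF _ open_exp_domain emeasure_exp_domain]
    by (intro conjI exI [of _ "{(?o, \<lambda>_. 0)}"] exI [of _ "\<lambda>_ _. pi\<^sup>2"]) auto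
qed

section \<open>Powers of \<open>exp z + z\<close> are not rational\<close>

text \<open>For real \<open>x \<ge> 0\<close> the power is at least \<open>exp x\<close>, so
  \<open>norm (poly Q x)\<close> is at most \<open>norm (poly P x) / exp x\<close>, which tends to
  0. A polynomial with limit 0 along the real axis is 0.\<close>

lemma exp_plus_power_transcendental:
  fixes P Q :: "complex poly"
  assumes eq: "\<And>x. (exp x + x) ^ k * poly Q x = poly P x" and k: "k > 0"
  shows "Q = 0"
proof (rule ccontr)
  assume Q: "Q \<noteq> 0"
  have "((\<lambda>x::real. norm (coeff P i) * (x ^ i / exp x)) \<longlongrightarrow> norm (coeff P i) * 0) at_top" for i
    by (intro tendsto_intros tendsto_power_div_exp_0)
  then have lim: "((\<lambda>x::real. \<Sum>i\<le>degree P. norm (coeff P i) * (x ^ i / exp x)) \<longlongrightarrow> 0) at_top"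
    by (intro tendsto_null_sum) simp
  have bound: "norm (poly Q (of_real x)) \<le> (\<Sum>i\<le>degree P. norm (coeff P i) * (x ^ i / exp x))" if x: "x \<ge> 0" for x :: real
  proof -
    have e: "exp (of_real x) + of_real x = complex_of_real (exp x + x)"
      by (simp add: exp_of_real)
    have "1 \<le> exp x"
      using x by simp
    then have "exp x \<le> exp x + x" "1 \<le> exp x + x"
      using x by linarith+
    moreover have "(exp x + x) ^ 1 \<le> (exp x + x) ^ k"
      using k calculation by (intro power_increasing) auto
    ultimately have "exp x \<le> (exp x + x) ^ k"
      by simp
    then have "exp x * norm (poly Q (of_real x)) \<le> (exp x + x) ^ k * norm (poly Q (of_real x))"
      by (intro mult_right_mono) auto
    also have "\<dots> = norm (poly P (of_real x))"
      using x unfolding eq [of "of_real x", symmetric] e norm_mult norm_power by (simp add: add_nonneg_nonneg del: of_real_add)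
    also have "\<dots> \<le> (\<Sum>i\<le>degree P. norm (coeff P i * of_real x ^ i))"
      unfolding poly_altdef by (rule norm_sum)
    also have "\<dots> = exp x * (\<Sum>i\<le>degree P. norm (coeff P i) * (x ^ i / exp x))"
      using x by (simp add: sum_distrib_left norm_mult norm_power)
    finally show ?thesis by simp
  qed
  have lim_Q: "((\<lambda>x::real. poly Q (of_real x)) \<longlongrightarrow> 0) at_top"
    by (rule Lim_null_comparison [OF _ lim]) (use bound in \<open>auto intro: eventually_mono [OF eventually_ge_at_top [of 0]]\<close>)
  have of_real: "filterlim (\<lambda>x::real. complex_of_real x) at_infinity at_top"
    by (simp add: filterlim_at_infinity_conv_norm_at_top filterlim_abs_real)
  show False
  proof (cases "degree Q > 0")
    case True
    have "filterlim (\<lambda>x::real. poly Q (of_real x)) at_infinity at_top"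
      using filterlim_compose [OF filterlim_poly_at_infinity [OF True] of_real] .
    then show False
      using not_tendsto_and_filterlim_at_infinity [OF _ lim_Q] by simp
  next
    case False
    then obtain c where "Q = [:c:]"
      by (metis degree_eq_zeroE neq0_conv)
    with lim_Q have "c = 0"
      by (simp add: tendsto_const_iff)
    with Q \<open>Q = [:c:]\<close> show False by simp
  qed
qed

section \<open>Rational functions of one variable on a set\<close>

text \<open>The denominator is cleared, so that the relation is one between entire functions
  whenever \<open>g\<close> is entire and can be continued analytically.\<close>

definition rational_on :: "complex set \<Rightarrow> (complex \<Rightarrow> complex) \<Rightarrow> bool" where
  "rational_on S g \<longleftrightarrow> (\<exists>P Q. \<forall>z\<in>S. poly Q z \<noteq> 0 \<and> g z * poly Q z = poly P z)"

lemma rational_on_cong: "(\<And>z. z \<in> S \<Longrightarrow> f z = g z) \<Longrightarrow> rational_on S f \<longleftrightarrow> rational_on S g"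
  unfolding rational_on_def by simp

lemma rational_on_poly: "rational_on S (poly p)"
  unfolding rational_on_def by (intro exI [of _ p] exI [of _ 1]) simp

lemma rational_on_const: "rational_on S (\<lambda>_. c)"
  unfolding rational_on_def by (intro exI [of _ "[:c:]"] exI [of _ 1]) simp

lemma rational_on_add:
  assumes "rational_on S f" "rational_on S g"
  shows "rational_on S (\<lambda>z. f z + g z)"
proof -
  obtain P1 Q1 P2 Q2 where "\<forall>z\<in>S. poly Q1 z \<noteq> 0 \<and> f z * poly Q1 z = poly P1 z"
    "\<forall>z\<in>S. poly Q2 z \<noteq> 0 \<and> g z * poly Q2 z = poly P2 z"
    using assms unfolding rational_on_def by blast
  then show ?thesis
    unfolding rational_on_def
    by (intro exI [of _ "P1 * Q2 + P2 * Q1"] exI [of _ "Q1 * Q2"]) (auto simp: algebra_simps)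
qed

lemma rational_on_mult:
  assumes "rational_on S f" "rational_on S g"
  shows "rational_on S (\<lambda>z. f z * g z)"
proof -
  obtain P1 Q1 P2 Q2 where "\<forall>z\<in>S. poly Q1 z \<noteq> 0 \<and> f z * poly Q1 z = poly P1 z"
    "\<forall>z\<in>S. poly Q2 z \<noteq> 0 \<and> g z * poly Q2 z = poly P2 z"
    using assms unfolding rational_on_def by blast
  then show ?thesis
    unfolding rational_on_def
    by (intro exI [of _ "P1 * P2"] exI [of _ "Q1 * Q2"]) (auto simp: mult_ac)
qed

lemma rational_on_inverse:
  assumes "rational_on S f" "\<And>z. z \<in> S \<Longrightarrow> f z \<noteq> 0"
  shows "rational_on S (\<lambda>z. inverse (f z))"
proof -
  obtain P Q where "\<forall>z\<in>S. poly Q z \<noteq> 0 \<and> f z * poly Q z = poly P z"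
    using assms unfolding rational_on_def by blast
  then show ?thesis
    using assms(2) unfolding rational_on_def
    by (intro exI [of _ Q] exI [of _ P]) (auto simp: field_simps)
qed

lemma rational_on_power: "rational_on S f \<Longrightarrow> rational_on S (\<lambda>z. f z ^ n)"
  by (induction n) (auto intro: rational_on_const rational_on_mult)

lemma rational_on_sum: "(\<And>i. i \<in> I \<Longrightarrow> rational_on S (f i)) \<Longrightarrow> rational_on S (\<lambda>z. \<Sum>i\<in>I. f i z)"
  by (induction I rule: infinite_finite_induct) (auto intro: rational_on_const rational_on_add)

text \<open>The relation on the disc extends to the whole plane, where it forces
  \<open>Q = 0\<close>; but \<open>Q\<close> has no zero on the disc.\<close>

lemma not_rational_on_exp_plus_power:
  assumes "k > 0"
  shows "\<not> rational_on (ball 0 1) (\<lambda>z. (exp z + z) ^ k)"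
proof
  assume "rational_on (ball 0 1) (\<lambda>z. (exp z + z) ^ k)"
  then obtain P Q where PQ: "\<forall>z\<in>ball (0 :: complex) 1. poly Q z \<noteq> 0 \<and> (exp z + z) ^ k * poly Q z = poly P z"
    unfolding rational_on_def by blast
  have "(exp x + x) ^ k * poly Q x = poly P x" for x
    by (rule analytic_continuation_open [of "ball 0 1" UNIV "\<lambda>z. (exp z + z) ^ k * poly Q z" "poly P"])
       (use PQ in \<open>auto intro!: holomorphic_intros\<close>)
  then have "Q = 0"
    using exp_plus_power_transcendental assms by blast
  with bspec [OF PQ, of 0] show False by simp
qed


section \<open>Antiholomorphic derivatives of the kernel\<close>

text \<open>In the type \<open>2\<close> arithmetic is modulo 2, so the index 2 is 0 and precedes 1.
  Hence \<open>multi_pd\<close> differentiates in the second coordinate first.\<close>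

lemma sorted_list_of_UNIV_2: "sorted_list_of_set (UNIV :: 2 set) = [2, 1]" 
proof -
  have "(0 :: 2) \<noteq> 1" by simp
  moreover have "(0 :: 2) \<le> 1"
    by (simp add: less_eq_bit0_def bit0.Rep_0 bit0.Rep_1)
  ultimately have "(0 :: 2) < 1"
    by (simp add: less_le)
  moreover have "(2 :: 2) = 0"
    by simp
  ultimately have "(2 :: 2) < 1"
    by (simp only:)
  then have "insort 1 [2 :: 2] = [2, 1]" "sorted [2, 1 :: 2]"
    by auto
  then show ?thesis
    unfolding UNIV_2 by (intro sorted_distinct_set_unique) auto
qed

section \<open>Linear combinations of functions of two points\<close>

text \<open>The coefficients depend on neither point, so differentiation in the second point acts
  linearly. The inductive form lets identities be checked on generators.\<close>

inductive_set lspan :: "('a \<Rightarrow> 'b \<Rightarrow> complex) set \<Rightarrow> ('a \<Rightarrow> 'b \<Rightarrow> complex) set" for B where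
  zero: "(\<lambda>_ _. 0) \<in> lspan B"
| step: "f \<in> lspan B \<Longrightarrow> b \<in> B \<Longrightarrow> (\<lambda>x y. f x y + c * b x y) \<in> lspan B"

lemma lspan_add:
  assumes "f \<in> lspan B" "g \<in> lspan B"
  shows "(\<lambda>x y. f x y + g x y) \<in> lspan B"
  using assms(2)
proof induction
  case (step g b c)
  from lspan.step [OF step.IH step.hyps(2), of c] show ?case
    by (simp add: add.assoc)
qed (use assms(1) in auto)

lemma lspan_scale: "f \<in> lspan B \<Longrightarrow> (\<lambda>x y. c * f x y) \<in> lspan B"
proof (induction f rule: lspan.induct)
  case (step g b d)
  from lspan.step [OF step.IH step.hyps(2), of "c * d"] show ?case
    by (simp add: algebra_simps)
qed (auto intro: lspan.zero)

lemma lspan_diff: "f \<in> lspan B \<Longrightarrow> g \<in> lspan B \<Longrightarrow> (\<lambda>x y. f x y - g x y) \<in> lspan B"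
  using lspan_add [OF _ lspan_scale [of g B "-1"]] by simp

lemma lspan_base: "b \<in> B \<Longrightarrow> b \<in> lspan B"
  using lspan.step [OF lspan.zero, of b B 1] by simp

lemma lspan_subset_lspan:
  assumes "B \<subseteq> lspan B'" shows "lspan B \<subseteq> lspan B'"
proof
  fix f assume "f \<in> lspan B"
  then show "f \<in> lspan B'"
  proof induction
    case (step f b c)
    then show ?case
      using assms by (intro lspan_add lspan_scale) auto
  qed (rule lspan.zero)
qed

section \<open>Antiholomorphic partial derivatives\<close>

text \<open>A relation recording existence and value together. Passing to the conjugate function
  makes the rules for complex derivatives available.\<close>

definition has_pd_bar :: "'n \<Rightarrow> (complex^'n \<Rightarrow> complex) \<Rightarrow> complex \<Rightarrow> complex^'n \<Rightarrow> bool" where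
  "has_pd_bar i f d w \<longleftrightarrow> ((\<lambda>t. cnj (f (w + axis i t))) has_field_derivative cnj d) (at 0)"

lemma has_pd_bar_imp_pd_bar:
  assumes "has_pd_bar i f d w"
  shows "pd_bar i f w = d"
proof -
  have f: "((\<lambda>t. cnj (f (w + axis i t))) has_field_derivative cnj d) (at 0)"
    using assms unfolding has_pd_bar_def .
  \<comment> \<open>The derivative in the real direction \<open>a\<close> is
    \<open>d * cnj a\<close>. For \<open>a = 1\<close> and \<open>a = \<i>\<close> the two summands
    in \<open>pd_bar\<close> are then both \<open>d\<close>.\<close>
  have d: "((\<lambda>t::real. f (w + axis i (a * of_real t))) has_vector_derivative cnj (cnj d * a)) (at 0)" for a
  proof -
    have "((\<lambda>t. cnj (f (w + axis i (a * t)))) has_field_derivative cnj d * a) (at (of_real 0))"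
      by (rule DERIV_chain2 [where f = "\<lambda>t. cnj (f (w + axis i t))"])
         (use f in \<open>auto intro!: derivative_eq_intros\<close>)
    from has_vector_derivative_real_field [OF this]
    have "((\<lambda>t::real. cnj (f (w + axis i (a * of_real t)))) has_vector_derivative cnj d * a) (at 0)"
      by simp
    from has_vector_derivative_cnj [OF this] show ?thesis by simp
  qed
  from vector_derivative_at [OF d [of 1]] vector_derivative_at [OF d [of \<i>]] show ?thesis
    by (simp add: pd_bar_def mult.commute [of d])
qed

lemma has_pd_bar_add:
  "has_pd_bar i f d w \<Longrightarrow> has_pd_bar i g e w \<Longrightarrow> has_pd_bar i (\<lambda>w. f w + g w) (d + e) w"
  unfolding has_pd_bar_def by (simp add: DERIV_add)

lemma has_pd_bar_cmult:
  "has_pd_bar i f d w \<Longrightarrow> has_pd_bar i (\<lambda>w. c * f w) (c * d) w"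
  unfolding has_pd_bar_def by (simp add: DERIV_cmult)

lemma continuous_on_axis:
  "continuous_on S f \<Longrightarrow> continuous_on S (\<lambda>x. axis i (f x) :: complex ^ 'n)"
  unfolding axis_def
proof (rule continuous_on_vec_lambda)
  show "continuous_on S f \<Longrightarrow> continuous_on S (\<lambda>x. if j = i then f x else 0)" for j
    by (cases "j = i") auto
qed

lemma axis_nhds:
  fixes w :: "complex ^ 'n"
  assumes "open S" "w \<in> S"
  obtains U where "open U" "0 \<in> U" "\<And>t. t \<in> U \<Longrightarrow> w + axis i t \<in> S"
proof
  have "continuous_on UNIV (\<lambda>t. w + axis i t)"
    by (intro continuous_intros continuous_on_axis)
  then show "open ((\<lambda>t. w + axis i t) -` S)"
    using assms(1) open_vimage by blast
qed (use assms(2) in \<open>auto simp: axis_eq_0_iff [THEN iffD2]\<close>)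

lemma has_pd_bar_cong:
  assumes "open S" "w \<in> S" "\<And>w. w \<in> S \<Longrightarrow> f w = g w" "has_pd_bar i f d w"
  shows "has_pd_bar i g d w"
proof -
  obtain U where "open U" "0 \<in> U" "\<And>t. t \<in> U \<Longrightarrow> w + axis i t \<in> S"
    using axis_nhds [OF assms(1,2)] by blast
  then show ?thesis
    using assms(3,4) unfolding has_pd_bar_def
    by (auto intro: has_field_derivative_transform_within_open [where S = U])
qed

text \<open>\<open>pd_bar\<close> depends only on the germ at \<open>w\<close>, whether or not the
  derivative exists. This is what lets iterated derivatives of cut-off functions be compared with
  those of the kernel.\<close>

lemma pd_bar_cong:
  assumes "open S" "w \<in> S" "\<And>w. w \<in> S \<Longrightarrow> f w = g w"
  shows "pd_bar i f w = pd_bar i g w"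
proof -
  have ev: "\<forall>\<^sub>F t in nhds (0 :: real). f (w + axis i (a * of_real t)) = g (w + axis i (a * of_real t))" for a
  proof -
    have "continuous_on UNIV (\<lambda>t :: real. w + axis i (a * of_real t))"
      by (intro continuous_intros continuous_on_axis)
    then have "open ((\<lambda>t :: real. w + axis i (a * of_real t)) -` S)"
      using assms(1) open_vimage by blast
    then have "\<forall>\<^sub>F t in nhds (0 :: real). t \<in> (\<lambda>t. w + axis i (a * of_real t)) -` S"
      by (rule eventually_nhds_in_open) (use assms(2) in \<open>auto simp: axis_eq_0_iff [THEN iffD2]\<close>)
    then show ?thesis
      by eventually_elim (use assms(3) in auto)
  qed
  have "vector_derivative (\<lambda>t :: real. f (w + axis i (a * of_real t))) (at 0)
      = vector_derivative (\<lambda>t :: real. g (w + axis i (a * of_real t))) (at 0)" for a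
    using ev [of a] by (intro vector_derivative_cong_eq) auto
  from this [of 1] this [of \<i>] show ?thesis
    by (simp add: pd_bar_def)
qed

lemma multi_pd_2: "multi_pd D \<alpha> f = (D 1 ^^ \<alpha> 1) ((D 2 ^^ \<alpha> 2) f)" for \<alpha> :: "2 \<Rightarrow> nat"
  by (simp add: multi_pd_def sorted_list_of_UNIV_2)

text \<open>The \<open>a\<close>-th derivative of \<open>1 / (1 - z * cnj w)\<^sup>2\<close> with respect to \<open>cnj w\<close>.\<close>

definition disc_kernel_deriv :: "nat \<Rightarrow> complex \<Rightarrow> complex \<Rightarrow> complex" where
  "disc_kernel_deriv a z w = fact (Suc a) * z ^ a * inverse (1 - z * cnj w) ^ (a + 2)"

lemma disc_kernel_deriv_deriv:
  assumes g: "(g has_field_derivative g') (at t)" and nz: "1 - z * cnj (g t) \<noteq> 0"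
  shows "((\<lambda>t. cnj (disc_kernel_deriv a z (g t))) has_field_derivative cnj (disc_kernel_deriv (Suc a) z (g t)) * g') (at t)"
proof -
  have nz': "1 - cnj z * g t \<noteq> 0"
    using nz complex_cnj_cancel_iff [of "1 - cnj z * g t" 0] by simp
  define I where "I = (\<lambda>t. inverse (1 - cnj z * g t))"
  have "(I has_field_derivative cnj z * g' * (I t)\<^sup>2) (at t)"
    unfolding I_def using nz'
    by (auto intro!: derivative_eq_intros g simp: power2_eq_square mult_ac)
  from DERIV_cmult [OF DERIV_power [OF this, of "a + 2"], of "fact (Suc a) * cnj z ^ a"]
  have "((\<lambda>t. fact (Suc a) * cnj z ^ a * I t ^ (a + 2)) has_field_derivative
      fact (Suc (Suc a)) * cnj z ^ Suc a * I t ^ (Suc a + 2) * g') (at t)"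
    by (rule DERIV_cong)
       (simp add: fact_Suc [of "Suc a"] power2_eq_square mult_ac del: fact_Suc)
  then show ?thesis
    by (simp add: disc_kernel_deriv_def I_def del: fact_Suc)
qed

text \<open>The multiple by \<open>exp (cnj (\<eta> $ 2)) ^ p\<close> of the derivative of the kernel of order \<open>(a, b)\<close> with
  respect to the conjugates of the coordinates \<open>u1 \<eta>, u2 \<eta>\<close>. Cutting off outside the domain turns the
  differentiation rules below into equations between functions.\<close>

definition exp_kernel_deriv :: "nat \<Rightarrow> nat \<Rightarrow> nat \<Rightarrow> complex ^ 2 \<Rightarrow> complex ^ 2 \<Rightarrow> complex" where
  "exp_kernel_deriv p a b \<zeta> \<eta> = (if \<zeta> \<in> exp_domain \<and> \<eta> \<in> exp_domain
     then exp (cnj (\<eta> $ 2)) ^ p * (disc_kernel_deriv a (u1 \<zeta>) (u1 \<eta>) * disc_kernel_deriv b (u2 \<zeta>) (u2 \<eta>)) / pi\<^sup>2 else 0)"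

lemma exp_kernel_deriv_0: "\<zeta> \<in> exp_domain \<Longrightarrow> \<eta> \<in> exp_domain \<Longrightarrow> exp_kernel_deriv 0 0 0 \<zeta> \<eta> = exp_kernel \<zeta> \<eta>"
  by (simp add: exp_kernel_deriv_def disc_kernel_deriv_def exp_kernel_def divide_inverse power2_eq_square mult_ac)

text \<open>Chain rule: the derivatives of \<open>(u1, u2)\<close> are \<open>(1, -1)\<close> in the
  first coordinate and \<open>(- exp (\<eta> $ 2), 1 + exp (\<eta> $ 2))\<close> in the second. Each
  exponential raises \<open>p\<close> by one, and the weight itself contributes the term with
  \<open>of_nat p\<close>.\<close>

lemma exp_kernel_deriv_has_pd_bar:
  assumes \<zeta>: "\<zeta> \<in> exp_domain" and \<eta>: "\<eta> \<in> exp_domain"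
  shows "has_pd_bar 1 (exp_kernel_deriv p a b \<zeta>) (exp_kernel_deriv p (Suc a) b \<zeta> \<eta> - exp_kernel_deriv p a (Suc b) \<zeta> \<eta>) \<eta>"
    and "has_pd_bar 2 (exp_kernel_deriv p a b \<zeta>) (of_nat p * exp_kernel_deriv p a b \<zeta> \<eta> - exp_kernel_deriv (Suc p) (Suc a) b \<zeta> \<eta>
      + exp_kernel_deriv p a (Suc b) \<zeta> \<eta> + exp_kernel_deriv (Suc p) a (Suc b) \<zeta> \<eta>) \<eta>"
proof -
  let ?h = "\<lambda>\<eta>. exp (cnj (\<eta> $ 2)) ^ p * (disc_kernel_deriv a (u1 \<zeta>) (u1 \<eta>) * disc_kernel_deriv b (u2 \<zeta>) (u2 \<eta>)) / pi\<^sup>2"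
  have h: "?h \<eta> = exp_kernel_deriv p a b \<zeta> \<eta>" if "\<eta> \<in> exp_domain" for \<eta>
    using \<zeta> that by (simp add: exp_kernel_deriv_def)
  note nz = one_minus_u_nonzero [OF \<zeta> \<eta>]
  have [simp]: "(2 :: 2) \<noteq> 1" "(1 :: 2) \<noteq> 2" by simp_all
  have u: "u1 (\<eta> + axis 1 t) = u1 \<eta> + t" "u2 (\<eta> + axis 1 t) = u2 \<eta> - t" "(\<eta> + axis 1 t) $ 2 = \<eta> $ 2" for t
    by (auto simp: u1_def u2_def axis_def)
  have "((\<lambda>t. cnj (?h (\<eta> + axis 1 t))) has_field_derivative
      cnj (exp_kernel_deriv p (Suc a) b \<zeta> \<eta> - exp_kernel_deriv p a (Suc b) \<zeta> \<eta>)) (at 0)"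
  proof -
    have A: "((\<lambda>t. cnj (disc_kernel_deriv a (u1 \<zeta>) (u1 \<eta> + t))) has_field_derivative cnj (disc_kernel_deriv (Suc a) (u1 \<zeta>) (u1 \<eta> + 0)) * 1) (at 0)"
      by (rule disc_kernel_deriv_deriv) (use nz in \<open>auto intro!: derivative_eq_intros\<close>)
    have B: "((\<lambda>t. cnj (disc_kernel_deriv b (u2 \<zeta>) (u2 \<eta> - t))) has_field_derivative cnj (disc_kernel_deriv (Suc b) (u2 \<zeta>) (u2 \<eta> - 0)) * (- 1)) (at 0)"
      by (rule disc_kernel_deriv_deriv) (use nz in \<open>auto intro!: derivative_eq_intros\<close>)
    have "((\<lambda>t. exp (\<eta> $ 2) ^ p * (cnj (disc_kernel_deriv a (u1 \<zeta>) (u1 \<eta> + t)) * cnj (disc_kernel_deriv b (u2 \<zeta>) (u2 \<eta> - t))) / pi\<^sup>2)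
      has_field_derivative
        exp (\<eta> $ 2) ^ p * (cnj (disc_kernel_deriv (Suc a) (u1 \<zeta>) (u1 \<eta>)) * cnj (disc_kernel_deriv b (u2 \<zeta>) (u2 \<eta>))
         - cnj (disc_kernel_deriv a (u1 \<zeta>) (u1 \<eta>)) * cnj (disc_kernel_deriv (Suc b) (u2 \<zeta>) (u2 \<eta>))) / pi\<^sup>2) (at 0)"
      by (rule DERIV_cdivide, rule DERIV_cong, rule DERIV_cmult [OF DERIV_mult [OF A B]])
         (simp add: algebra_simps)
    then show ?thesis
      unfolding u using \<zeta> \<eta>
      by (simp add: exp_kernel_deriv_def exp_cnj [symmetric] right_diff_distrib diff_divide_distrib)
  qed
  then have "has_pd_bar 1 ?h (exp_kernel_deriv p (Suc a) b \<zeta> \<eta> - exp_kernel_deriv p a (Suc b) \<zeta> \<eta>) \<eta>"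
    unfolding has_pd_bar_def .
  then show "has_pd_bar 1 (exp_kernel_deriv p a b \<zeta>) (exp_kernel_deriv p (Suc a) b \<zeta> \<eta> - exp_kernel_deriv p a (Suc b) \<zeta> \<eta>) \<eta>"
    by (rule has_pd_bar_cong [OF open_exp_domain \<eta>, rotated]) (rule h)
  have v: "u1 (\<eta> + axis 2 t) = \<eta> $ 1 - exp (\<eta> $ 2 + t)" "u2 (\<eta> + axis 2 t) = \<eta> $ 2 + t - \<eta> $ 1 + exp (\<eta> $ 2 + t)"
    "(\<eta> + axis 2 t) $ 2 = \<eta> $ 2 + t" for t
    by (auto simp: u1_def u2_def axis_def)
  have "((\<lambda>t. cnj (?h (\<eta> + axis 2 t))) has_field_derivative
      cnj (of_nat p * exp_kernel_deriv p a b \<zeta> \<eta> - exp_kernel_deriv (Suc p) (Suc a) b \<zeta> \<eta>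
      + exp_kernel_deriv p a (Suc b) \<zeta> \<eta> + exp_kernel_deriv (Suc p) a (Suc b) \<zeta> \<eta>)) (at 0)"
  proof -
    have A: "((\<lambda>t. cnj (disc_kernel_deriv a (u1 \<zeta>) (\<eta> $ 1 - exp (\<eta> $ 2 + t)))) has_field_derivative
        cnj (disc_kernel_deriv (Suc a) (u1 \<zeta>) (\<eta> $ 1 - exp (\<eta> $ 2 + 0))) * (- exp (\<eta> $ 2))) (at 0)"
      by (rule disc_kernel_deriv_deriv) (use nz in \<open>auto simp: u1_def intro!: derivative_eq_intros\<close>)
    have B: "((\<lambda>t. cnj (disc_kernel_deriv b (u2 \<zeta>) (\<eta> $ 2 + t - \<eta> $ 1 + exp (\<eta> $ 2 + t)))) has_field_derivative
        cnj (disc_kernel_deriv (Suc b) (u2 \<zeta>) (\<eta> $ 2 + 0 - \<eta> $ 1 + exp (\<eta> $ 2 + 0))) * (1 + exp (\<eta> $ 2))) (at 0)"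
      by (rule disc_kernel_deriv_deriv) (use nz in \<open>auto simp: u2_def intro!: derivative_eq_intros\<close>)
    have C: "((\<lambda>t. exp (\<eta> $ 2 + t) ^ p) has_field_derivative of_nat p * exp (\<eta> $ 2) ^ p) (at 0)"
    proof -
      have "((\<lambda>t. exp (\<eta> $ 2 + t)) has_field_derivative exp (\<eta> $ 2)) (at 0)"
        by (auto intro!: derivative_eq_intros)
      from DERIV_power [OF this, of p] show ?thesis
        by (rule DERIV_cong) (cases p, simp_all)
    qed
    have "((\<lambda>t. exp (\<eta> $ 2 + t) ^ p * (cnj (disc_kernel_deriv a (u1 \<zeta>) (\<eta> $ 1 - exp (\<eta> $ 2 + t))) *
         cnj (disc_kernel_deriv b (u2 \<zeta>) (\<eta> $ 2 + t - \<eta> $ 1 + exp (\<eta> $ 2 + t)))) / pi\<^sup>2) has_field_derivative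
      (of_nat p * exp (\<eta> $ 2) ^ p * (cnj (disc_kernel_deriv a (u1 \<zeta>) (u1 \<eta>)) * cnj (disc_kernel_deriv b (u2 \<zeta>) (u2 \<eta>)))
       + exp (\<eta> $ 2) ^ p * (cnj (disc_kernel_deriv (Suc a) (u1 \<zeta>) (u1 \<eta>)) * (- exp (\<eta> $ 2)) * cnj (disc_kernel_deriv b (u2 \<zeta>) (u2 \<eta>))
         + cnj (disc_kernel_deriv a (u1 \<zeta>) (u1 \<eta>)) * (cnj (disc_kernel_deriv (Suc b) (u2 \<zeta>) (u2 \<eta>)) * (1 + exp (\<eta> $ 2))))) / pi\<^sup>2) (at 0)"
      by (rule DERIV_cdivide, rule DERIV_cong, rule DERIV_mult [OF C DERIV_mult [OF A B]])
         (simp add: u1_def u2_def algebra_simps)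
    moreover have "cnj (?h (\<eta> + axis 2 t)) = exp (\<eta> $ 2 + t) ^ p * (cnj (disc_kernel_deriv a (u1 \<zeta>) (\<eta> $ 1 - exp (\<eta> $ 2 + t))) *
         cnj (disc_kernel_deriv b (u2 \<zeta>) (\<eta> $ 2 + t - \<eta> $ 1 + exp (\<eta> $ 2 + t)))) / pi\<^sup>2" for t
      unfolding v by (simp add: exp_cnj)
    moreover have "cnj (of_nat p * exp_kernel_deriv p a b \<zeta> \<eta> - exp_kernel_deriv (Suc p) (Suc a) b \<zeta> \<eta>
      + exp_kernel_deriv p a (Suc b) \<zeta> \<eta> + exp_kernel_deriv (Suc p) a (Suc b) \<zeta> \<eta>) =
      (of_nat p * exp (\<eta> $ 2) ^ p * (cnj (disc_kernel_deriv a (u1 \<zeta>) (u1 \<eta>)) * cnj (disc_kernel_deriv b (u2 \<zeta>) (u2 \<eta>)))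
       + exp (\<eta> $ 2) ^ p * (cnj (disc_kernel_deriv (Suc a) (u1 \<zeta>) (u1 \<eta>)) * (- exp (\<eta> $ 2)) * cnj (disc_kernel_deriv b (u2 \<zeta>) (u2 \<eta>))
         + cnj (disc_kernel_deriv a (u1 \<zeta>) (u1 \<eta>)) * (cnj (disc_kernel_deriv (Suc b) (u2 \<zeta>) (u2 \<eta>)) * (1 + exp (\<eta> $ 2))))) / pi\<^sup>2"
      using \<zeta> \<eta>
      by (simp add: exp_kernel_deriv_def exp_cnj [symmetric] add_divide_distrib [symmetric] diff_divide_distrib [symmetric] times_divide_eq_right)
         (simp add: algebra_simps)
    ultimately show ?thesis by (simp only:)
  qed
  then have "has_pd_bar 2 ?h (of_nat p * exp_kernel_deriv p a b \<zeta> \<eta> - exp_kernel_deriv (Suc p) (Suc a) b \<zeta> \<eta>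
      + exp_kernel_deriv p a (Suc b) \<zeta> \<eta> + exp_kernel_deriv (Suc p) a (Suc b) \<zeta> \<eta>) \<eta>"
    unfolding has_pd_bar_def .
  then show "has_pd_bar 2 (exp_kernel_deriv p a b \<zeta>) (of_nat p * exp_kernel_deriv p a b \<zeta> \<eta> - exp_kernel_deriv (Suc p) (Suc a) b \<zeta> \<eta>
      + exp_kernel_deriv p a (Suc b) \<zeta> \<eta> + exp_kernel_deriv (Suc p) a (Suc b) \<zeta> \<eta>) \<eta>"
    by (rule has_pd_bar_cong [OF open_exp_domain \<eta>, rotated]) (rule h)
qed

section \<open>The operators \<open>dbar 1\<close>, \<open>dbar 2\<close> and the exponential
  weight\<close>

text \<open>An operator on functions of two points, cut off like \<open>exp_kernel_deriv\<close>, so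
  that the differentiation rules can be rewritten inside iterates.\<close>

definition dbar :: "2 \<Rightarrow> (complex ^ 2 \<Rightarrow> complex ^ 2 \<Rightarrow> complex) \<Rightarrow> complex ^ 2 \<Rightarrow> complex ^ 2 \<Rightarrow> complex" where
  "dbar i \<Phi> \<zeta> \<eta> = (if \<zeta> \<in> exp_domain \<and> \<eta> \<in> exp_domain then pd_bar i (\<Phi> \<zeta>) \<eta> else 0)"

text \<open>This factor varies with \<open>\<eta>\<close>, so it cannot be a coefficient in
  \<open>lspan\<close>; it becomes a scalar only after \<open>\<eta>\<close> is fixed.\<close>

definition mult_exp_cnj :: "(complex ^ 2 \<Rightarrow> complex ^ 2 \<Rightarrow> complex) \<Rightarrow> complex ^ 2 \<Rightarrow> complex ^ 2 \<Rightarrow> complex" where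
  "mult_exp_cnj \<Phi> \<zeta> \<eta> = exp (cnj (\<eta> $ 2)) * \<Phi> \<zeta> \<eta>"

definition exp_kernel_derivs :: "(complex ^ 2 \<Rightarrow> complex ^ 2 \<Rightarrow> complex) set" where
  "exp_kernel_derivs = {exp_kernel_deriv p a b | p a b. True}"

lemma exp_kernel_deriv_in_lspan: "exp_kernel_deriv p a b \<in> lspan exp_kernel_derivs"
  by (rule lspan_base) (auto simp: exp_kernel_derivs_def)

lemmas lspan_intros = lspan.zero lspan_add lspan_diff lspan_scale exp_kernel_deriv_in_lspan

text \<open>\<open>pd_bar\<close> is total, and its sum rule relies on existing derivatives. Their
  existence on this span is what makes \<open>dbar\<close> linear there.\<close>

lemma has_pd_bar_lspan:
  assumes "\<Phi> \<in> lspan exp_kernel_derivs" "\<zeta> \<in> exp_domain" "\<eta> \<in> exp_domain"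
  shows "has_pd_bar i (\<Phi> \<zeta>) (dbar i \<Phi> \<zeta> \<eta>) \<eta>"
proof -
  have "\<exists>d. has_pd_bar i (\<Phi> \<zeta>) d \<eta>"
    using assms(1)
  proof induction
    case zero
    have "has_pd_bar i (\<lambda>_. 0) 0 \<eta>"
      by (simp add: has_pd_bar_def)
    then show ?case by blast
  next
    case (step f b c)
    then obtain p a a' where b: "b = exp_kernel_deriv p a a'"
      by (auto simp: exp_kernel_derivs_def)
    have "i = 1 \<or> i = 2"
      by (rule exhaust_2)
    then have "\<exists>d. has_pd_bar i (b \<zeta>) d \<eta>"
      unfolding b by (elim disjE; hypsubst) (rule exI, rule exp_kernel_deriv_has_pd_bar [OF assms(2,3)])+
    with step.IH show ?case
      using has_pd_bar_add has_pd_bar_cmult by blast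
  qed
  then show ?thesis
    using has_pd_bar_imp_pd_bar assms(2,3) by (auto simp: dbar_def)
qed

lemma dbar_eqI:
  assumes "\<And>\<zeta> \<eta>. \<zeta> \<in> exp_domain \<Longrightarrow> \<eta> \<in> exp_domain \<Longrightarrow> has_pd_bar i (\<Phi> \<zeta>) (\<Psi> \<zeta> \<eta>) \<eta>"
    and "\<And>\<zeta> \<eta>. \<not> (\<zeta> \<in> exp_domain \<and> \<eta> \<in> exp_domain) \<Longrightarrow> \<Psi> \<zeta> \<eta> = 0"
  shows "dbar i \<Phi> = \<Psi>"
  using assms by (auto simp: fun_eq_iff dbar_def has_pd_bar_imp_pd_bar)

lemma dbar_outside: "\<not> (\<zeta> \<in> exp_domain \<and> \<eta> \<in> exp_domain) \<Longrightarrow> dbar i \<Phi> \<zeta> \<eta> = 0"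
  by (auto simp: dbar_def)

lemma dbar_add:
  assumes "f \<in> lspan exp_kernel_derivs" "g \<in> lspan exp_kernel_derivs"
  shows "dbar i (\<lambda>x y. f x y + g x y) = (\<lambda>x y. dbar i f x y + dbar i g x y)"
  by (rule dbar_eqI) (auto intro: has_pd_bar_add has_pd_bar_lspan assms simp: dbar_outside)

lemma dbar_scale:
  assumes "f \<in> lspan exp_kernel_derivs"
  shows "dbar i (\<lambda>x y. c * f x y) = (\<lambda>x y. c * dbar i f x y)"
  by (rule dbar_eqI) (auto intro: has_pd_bar_cmult has_pd_bar_lspan assms simp: dbar_outside)

lemma dbar_diff:
  assumes "f \<in> lspan exp_kernel_derivs" "g \<in> lspan exp_kernel_derivs"
  shows "dbar i (\<lambda>x y. f x y - g x y) = (\<lambda>x y. dbar i f x y - dbar i g x y)"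
  using dbar_add [OF assms(1) lspan_scale [OF assms(2)], of i "-1"] dbar_scale [OF assms(2), of i "-1"]
  by simp

lemma dbar_zero: "dbar i (\<lambda>_ _. 0) = (\<lambda>_ _. 0)"
  using dbar_scale [OF lspan.zero, of i 0] by simp

lemma dbar_exp_kernel_deriv:
  "dbar 1 (exp_kernel_deriv p a b) = (\<lambda>x y. exp_kernel_deriv p (Suc a) b x y - exp_kernel_deriv p a (Suc b) x y)"
  "dbar 2 (exp_kernel_deriv p a b) = (\<lambda>x y. of_nat p * exp_kernel_deriv p a b x y - exp_kernel_deriv (Suc p) (Suc a) b x y
      + exp_kernel_deriv p a (Suc b) x y + exp_kernel_deriv (Suc p) a (Suc b) x y)"
  subgoal by (rule dbar_eqI, erule (1) exp_kernel_deriv_has_pd_bar) (auto simp: exp_kernel_deriv_def)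
  subgoal by (rule dbar_eqI, erule (1) exp_kernel_deriv_has_pd_bar) (auto simp: exp_kernel_deriv_def)
  done

lemma dbar_lspan_exp_kernel_derivs:
  assumes "\<Phi> \<in> lspan exp_kernel_derivs"
  shows "dbar i \<Phi> \<in> lspan exp_kernel_derivs"
  using assms
proof induction
  case zero
  then show ?case by (simp add: dbar_zero lspan.zero)
next
  case (step f b c)
  then obtain p a a' where b: "b = exp_kernel_deriv p a a'"
    by (auto simp: exp_kernel_derivs_def)
  have "i = 1 \<or> i = 2"
    by (rule exhaust_2)
  then have "dbar i b \<in> lspan exp_kernel_derivs"
    unfolding b by (auto simp: dbar_exp_kernel_deriv intro!: lspan_intros)
  then show ?case
    using step by (simp add: b dbar_add dbar_scale lspan_intros)
qed

lemma dbar_pow_lspan_exp_kernel_derivs: "\<Phi> \<in> lspan exp_kernel_derivs \<Longrightarrow> (dbar i ^^ n) \<Phi> \<in> lspan exp_kernel_derivs"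
  by (induction n) (auto intro: dbar_lspan_exp_kernel_derivs)

text \<open>On generators this is read off from the explicit formulas, and linearity extends it. It
  serves to put iterated derivatives into the order of \<open>multi_pd\<close>.\<close>

lemma dbar_commute:
  assumes "\<Phi> \<in> lspan exp_kernel_derivs"
  shows "dbar 2 (dbar 1 \<Phi>) = dbar 1 (dbar 2 \<Phi>)"
  using assms
proof induction
  case zero
  then show ?case by (simp add: dbar_zero)
next
  case (step f b c)
  then obtain p a a' where b: "b = exp_kernel_deriv p a a'"
    by (auto simp: exp_kernel_derivs_def)
  have "dbar 2 (dbar 1 b) = dbar 1 (dbar 2 b)"
    unfolding b by (simp add: dbar_exp_kernel_deriv dbar_add dbar_diff dbar_scale lspan_intros fun_eq_iff algebra_simps)
  then show ?case
    using step by (simp add: b dbar_add dbar_scale lspan_intros dbar_lspan_exp_kernel_derivs)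
qed

lemma dbar_2_dbar_1_pow:
  "\<Phi> \<in> lspan exp_kernel_derivs \<Longrightarrow> dbar 2 ((dbar 1 ^^ n) \<Phi>) = (dbar 1 ^^ n) (dbar 2 \<Phi>)"
  by (induction n) (simp_all add: dbar_commute dbar_pow_lspan_exp_kernel_derivs)

lemma mult_exp_cnj_linear:
  "mult_exp_cnj (\<lambda>x y. f x y + g x y) = (\<lambda>x y. mult_exp_cnj f x y + mult_exp_cnj g x y)"
  "mult_exp_cnj (\<lambda>x y. f x y - g x y) = (\<lambda>x y. mult_exp_cnj f x y - mult_exp_cnj g x y)"
  "mult_exp_cnj (\<lambda>x y. c * f x y) = (\<lambda>x y. c * mult_exp_cnj f x y)"
  "mult_exp_cnj (\<lambda>_ _. 0) = (\<lambda>_ _. 0)"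
  by (simp_all add: mult_exp_cnj_def fun_eq_iff algebra_simps)

lemma mult_exp_cnj_exp_kernel_deriv: "mult_exp_cnj (exp_kernel_deriv p a b) = exp_kernel_deriv (Suc p) a b"
  by (simp add: mult_exp_cnj_def exp_kernel_deriv_def fun_eq_iff)

lemma mult_exp_cnj_pow_exp_kernel_deriv: "(mult_exp_cnj ^^ n) (exp_kernel_deriv p a b) = exp_kernel_deriv (n + p) a b"
  by (induction n) (simp_all add: mult_exp_cnj_exp_kernel_deriv)

lemma mult_exp_cnj_lspan:
  assumes "f \<in> lspan B" "\<And>b. b \<in> B \<Longrightarrow> mult_exp_cnj b \<in> lspan B'"
  shows "mult_exp_cnj f \<in> lspan B'"
  using assms(1) by induction (simp_all add: mult_exp_cnj_linear lspan.zero lspan_add lspan_scale assms(2))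

lemma mult_exp_cnj_pow_lspan_exp_kernel_derivs: "f \<in> lspan exp_kernel_derivs \<Longrightarrow> (mult_exp_cnj ^^ n) f \<in> lspan exp_kernel_derivs"
proof (induction n)
  case (Suc n)
  have "mult_exp_cnj b \<in> lspan exp_kernel_derivs" if b: "b \<in> exp_kernel_derivs" for b
  proof -
    obtain p a a' where "b = exp_kernel_deriv p a a'"
      using b by (auto simp: exp_kernel_derivs_def)
    then show ?thesis
      by (simp add: mult_exp_cnj_exp_kernel_deriv exp_kernel_deriv_in_lspan)
  qed
  then show ?case
    using mult_exp_cnj_lspan [OF Suc.IH [OF Suc.prems]] by simp
qed simp

text \<open>Leibniz rule: the weight is constant in the first coordinate and equal to its own
  antiholomorphic derivative in the second.\<close>

lemma dbar_mult_exp_cnj: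
  assumes "\<Phi> \<in> lspan exp_kernel_derivs"
  shows "dbar 1 (mult_exp_cnj \<Phi>) = mult_exp_cnj (dbar 1 \<Phi>)"
    and "dbar 2 (mult_exp_cnj \<Phi>) = (\<lambda>x y. mult_exp_cnj \<Phi> x y + mult_exp_cnj (dbar 2 \<Phi>) x y)"
proof -
  have "dbar 1 (mult_exp_cnj \<Phi>) = mult_exp_cnj (dbar 1 \<Phi>) \<and> dbar 2 (mult_exp_cnj \<Phi>) = (\<lambda>x y. mult_exp_cnj \<Phi> x y + mult_exp_cnj (dbar 2 \<Phi>) x y)"
    using assms
  proof induction
    case zero
    then show ?case by (simp add: dbar_zero mult_exp_cnj_linear)
  next
    case (step f b c)
    then obtain p a a' where b: "b = exp_kernel_deriv p a a'"
      by (auto simp: exp_kernel_derivs_def)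
    have "mult_exp_cnj f \<in> lspan exp_kernel_derivs"
      using mult_exp_cnj_pow_lspan_exp_kernel_derivs [OF step.hyps(1), of 1] by simp
    then show ?case
      using step
      by (simp add: b mult_exp_cnj_linear mult_exp_cnj_exp_kernel_deriv dbar_exp_kernel_deriv dbar_add dbar_scale lspan_intros fun_eq_iff algebra_simps)
  qed
  then show "dbar 1 (mult_exp_cnj \<Phi>) = mult_exp_cnj (dbar 1 \<Phi>)"
    "dbar 2 (mult_exp_cnj \<Phi>) = (\<lambda>x y. mult_exp_cnj \<Phi> x y + mult_exp_cnj (dbar 2 \<Phi>) x y)"
    by auto
qed

lemma dbar_mult_exp_cnj_pow:
  assumes "\<Phi> \<in> lspan exp_kernel_derivs"
  shows "dbar 1 ((mult_exp_cnj ^^ n) \<Phi>) = (mult_exp_cnj ^^ n) (dbar 1 \<Phi>)"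
    and "dbar 2 ((mult_exp_cnj ^^ n) \<Phi>) = (\<lambda>x y. of_nat n * (mult_exp_cnj ^^ n) \<Phi> x y + (mult_exp_cnj ^^ n) (dbar 2 \<Phi>) x y)"
  by (induction n)
     (simp_all add: dbar_mult_exp_cnj mult_exp_cnj_pow_lspan_exp_kernel_derivs assms mult_exp_cnj_linear algebra_simps)

section \<open>Equivalence of zeta-derivatives and u-derivatives of the kernel\<close>

text \<open>A normal form: the derivatives stand in the order of \<open>multi_pd\<close>, with all
  weights in front. The weights are included because u-derivatives have them as
  coefficients.\<close>

definition kernel_pd_bars :: "(complex ^ 2 \<Rightarrow> complex ^ 2 \<Rightarrow> complex) set" where
  "kernel_pd_bars = {(mult_exp_cnj ^^ p) ((dbar 1 ^^ a) ((dbar 2 ^^ b) (exp_kernel_deriv 0 0 0))) | p a b. True}"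

lemma kernel_pd_bars_subset: "kernel_pd_bars \<subseteq> lspan exp_kernel_derivs"
  unfolding kernel_pd_bars_def by (auto intro!: mult_exp_cnj_pow_lspan_exp_kernel_derivs dbar_pow_lspan_exp_kernel_derivs exp_kernel_deriv_in_lspan)

lemma kernel_pd_bars_I: "(mult_exp_cnj ^^ p) ((dbar 1 ^^ a) ((dbar 2 ^^ b) (exp_kernel_deriv 0 0 0))) \<in> lspan kernel_pd_bars"
  by (rule lspan_base) (auto simp: kernel_pd_bars_def)

lemma mult_exp_cnj_lspan_kernel_pd_bars: "f \<in> lspan kernel_pd_bars \<Longrightarrow> mult_exp_cnj f \<in> lspan kernel_pd_bars"
proof (erule mult_exp_cnj_lspan)
  fix g assume "g \<in> kernel_pd_bars"
  then obtain p a b where "g = (mult_exp_cnj ^^ p) ((dbar 1 ^^ a) ((dbar 2 ^^ b) (exp_kernel_deriv 0 0 0)))"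
    unfolding kernel_pd_bars_def by auto
  then show "mult_exp_cnj g \<in> lspan kernel_pd_bars"
    using kernel_pd_bars_I [of "Suc p" a b] by simp
qed

text \<open>The commutation rules move a new derivative past the weights, and past
  \<open>dbar 1\<close>, to its place in the normal form; the only extra term is
  \<open>of_nat p * g\<close>.\<close>

lemma dbar_lspan_kernel_pd_bars:
  assumes "f \<in> lspan kernel_pd_bars"
  shows "dbar i f \<in> lspan kernel_pd_bars"
  using assms
proof induction
  case zero
  then show ?case by (simp add: dbar_zero lspan.zero)
next
  case (step f g c)
  then obtain p a b where g: "g = (mult_exp_cnj ^^ p) ((dbar 1 ^^ a) ((dbar 2 ^^ b) (exp_kernel_deriv 0 0 0)))"
    unfolding kernel_pd_bars_def by auto
  have K: "(dbar 1 ^^ a) ((dbar 2 ^^ b) (exp_kernel_deriv 0 0 0)) \<in> lspan exp_kernel_derivs" "(dbar 2 ^^ b) (exp_kernel_deriv 0 0 0) \<in> lspan exp_kernel_derivs"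
    by (auto intro!: dbar_pow_lspan_exp_kernel_derivs exp_kernel_deriv_in_lspan)
  have "dbar 1 g = (mult_exp_cnj ^^ p) ((dbar 1 ^^ Suc a) ((dbar 2 ^^ b) (exp_kernel_deriv 0 0 0)))"
    using K by (simp add: g dbar_mult_exp_cnj_pow)
  then have 1: "dbar 1 g \<in> lspan kernel_pd_bars"
    using kernel_pd_bars_I by metis
  have "dbar 2 g = (\<lambda>x y. of_nat p * g x y + (mult_exp_cnj ^^ p) ((dbar 1 ^^ a) ((dbar 2 ^^ Suc b) (exp_kernel_deriv 0 0 0))) x y)"
    using K by (simp add: g dbar_mult_exp_cnj_pow dbar_2_dbar_1_pow)
  also have "\<dots> \<in> lspan kernel_pd_bars"
    unfolding g by (intro lspan_add lspan_scale kernel_pd_bars_I)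
  finally have "dbar i g \<in> lspan kernel_pd_bars"
    using 1 exhaust_2 [of i] by auto
  moreover have "f \<in> lspan exp_kernel_derivs" "g \<in> lspan exp_kernel_derivs"
    using step lspan_subset_lspan [OF kernel_pd_bars_subset] kernel_pd_bars_subset by auto
  ultimately show ?case
    using step by (simp add: dbar_add dbar_scale lspan_add lspan_scale)
qed

text \<open>In the coordinates \<open>u = (u1, u2)\<close> the kernel operators are
  \<open>\<partial>/\<partial>u2-bar = dbar 2 + mult_exp_cnj \<circ> dbar 1\<close> and \<open>\<partial>/\<partial>u1-bar = \<partial>/\<partial>u2-bar + dbar 1\<close>.\<close>

lemma exp_kernel_deriv_in_lspan_kernel_pd_bars: "exp_kernel_deriv p a b \<in> lspan kernel_pd_bars"
proof (induction b arbitrary: p a)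
  case 0
  show ?case
  proof (induction a arbitrary: p)
    case 0
    show ?case
      using kernel_pd_bars_I [of p 0 0] by (simp add: mult_exp_cnj_pow_exp_kernel_deriv)
  next
    case (Suc a)
    let ?K = "exp_kernel_deriv p a 0"
    \<comment> \<open>The term with \<open>of_nat p\<close> removes what differentiating the weight
      contributes to \<open>dbar 2 ?K\<close>. The terms of order \<open>(a, 1)\<close> cancel, as
      do the two of order \<open>(a + 1, 0)\<close> with weight \<open>Suc p\<close>.\<close>
    have "exp_kernel_deriv p (Suc a) 0 = (\<lambda>x y. dbar 2 ?K x y - of_nat p * ?K x y + dbar 1 ?K x y + mult_exp_cnj (dbar 1 ?K) x y)"
      by (simp add: dbar_exp_kernel_deriv mult_exp_cnj_linear mult_exp_cnj_exp_kernel_deriv)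
    also have "\<dots> \<in> lspan kernel_pd_bars"
      by (intro lspan_add lspan_diff lspan_scale dbar_lspan_kernel_pd_bars mult_exp_cnj_lspan_kernel_pd_bars Suc)
    finally show ?case .
  qed
next
  case (Suc b)
  \<comment> \<open>\<open>dbar 1\<close> is the difference of the two u-derivatives, so one order
    in \<open>b\<close> is traded for one in \<open>a\<close>; hence \<open>a\<close> is arbitrary
    in the induction.\<close>
  have "exp_kernel_deriv p a (Suc b) = (\<lambda>x y. exp_kernel_deriv p (Suc a) b x y - dbar 1 (exp_kernel_deriv p a b) x y)"
    by (simp add: dbar_exp_kernel_deriv)
  also have "\<dots> \<in> lspan kernel_pd_bars"
    by (intro lspan_diff dbar_lspan_kernel_pd_bars Suc)
  finally show ?case .
qed

lemma dbar_pow_eq_pd_bar_pow: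
  assumes "\<zeta> \<in> exp_domain" "\<And>\<eta>. \<eta> \<in> exp_domain \<Longrightarrow> \<Phi> \<zeta> \<eta> = \<phi> \<eta>" "\<eta> \<in> exp_domain"
  shows "(dbar i ^^ n) \<Phi> \<zeta> \<eta> = (pd_bar i ^^ n) \<phi> \<eta>"
  using assms(3)
proof (induction n arbitrary: \<eta>)
  case 0
  then show ?case using assms(2) by simp
next
  case (Suc n)
  have "pd_bar i ((dbar i ^^ n) \<Phi> \<zeta>) \<eta> = pd_bar i ((pd_bar i ^^ n) \<phi>) \<eta>"
    by (rule pd_bar_cong [OF open_exp_domain Suc.prems Suc.IH])
  then show ?case
    using assms(1) Suc.prems by (simp add: dbar_def [of i "(dbar i ^^ n) \<Phi>"])
qed

lemma multi_pd_bar_bergman_kernel: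
  assumes "\<zeta> \<in> exp_domain" "\<eta> \<in> exp_domain"
  shows "multi_pd pd_bar \<alpha> (bergman_kernel exp_domain \<zeta>) \<eta>
    = (dbar 1 ^^ \<alpha> 1) ((dbar 2 ^^ \<alpha> 2) (exp_kernel_deriv 0 0 0)) \<zeta> \<eta>"
proof -
  have 0: "exp_kernel_deriv 0 0 0 \<zeta> \<eta> = bergman_kernel exp_domain \<zeta> \<eta>" if "\<eta> \<in> exp_domain" for \<eta>
    using bergman_kernel_exp_domain exp_kernel_deriv_0 assms(1) that by simp
  have 1: "(dbar 2 ^^ \<alpha> 2) (exp_kernel_deriv 0 0 0) \<zeta> \<eta> = (pd_bar 2 ^^ \<alpha> 2) (bergman_kernel exp_domain \<zeta>) \<eta>"
    if "\<eta> \<in> exp_domain" for \<eta>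
    by (rule dbar_pow_eq_pd_bar_pow [OF assms(1) _ that]) (rule 0)
  show ?thesis
    unfolding multi_pd_2
    by (rule dbar_pow_eq_pd_bar_pow [OF assms(1) _ assms(2), symmetric]) (rule 1)
qed

section \<open>The Bergman span as a vector space\<close>

lemma bergman_span_kernel: "w \<in> \<Omega> \<Longrightarrow> (\<lambda>z. multi_pd pd_bar \<alpha> (bergman_kernel \<Omega> z) w) \<in> bergman_span \<Omega>"
  unfolding bergman_span_def by (intro CollectI exI [of _ "{(w, \<alpha>)}"] exI [of _ "\<lambda>_ _. 1"]) auto

lemma bergman_span_cong:
  assumes "f \<in> bergman_span \<Omega>" "\<And>z. z \<in> \<Omega> \<Longrightarrow> g z = f z"
  shows "g \<in> bergman_span \<Omega>"
  using assms unfolding bergman_span_def by simp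

lemma bergman_span_scale:
  assumes "f \<in> bergman_span \<Omega>" shows "(\<lambda>z. a * f z) \<in> bergman_span \<Omega>"
proof -
  obtain T c where T: "finite T" "fst ` T \<subseteq> \<Omega>"
    "\<forall>z\<in>\<Omega>. f z = (\<Sum>(w, \<alpha>)\<in>T. c w \<alpha> * multi_pd pd_bar \<alpha> (bergman_kernel \<Omega> z) w)"
    using assms unfolding bergman_span_def by blast
  then show ?thesis
    unfolding bergman_span_def
    by (intro CollectI exI [of _ T] exI [of _ "\<lambda>w \<alpha>. a * c w \<alpha>"])
       (simp add: sum_distrib_left case_prod_unfold mult.assoc)
qed

lemma bergman_span_add:
  assumes "f \<in> bergman_span \<Omega>" "g \<in> bergman_span \<Omega>"
  shows "(\<lambda>z. f z + g z) \<in> bergman_span \<Omega>"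
proof -
  define K where "K = (\<lambda>z p. multi_pd pd_bar (snd p) (bergman_kernel \<Omega> z) (fst p))"
  obtain T c where T: "finite T" "fst ` T \<subseteq> \<Omega>" "\<forall>z\<in>\<Omega>. f z = (\<Sum>p\<in>T. c (fst p) (snd p) * K z p)"
    using assms(1) unfolding bergman_span_def K_def case_prod_unfold by blast
  obtain U d where U: "finite U" "fst ` U \<subseteq> \<Omega>" "\<forall>z\<in>\<Omega>. g z = (\<Sum>p\<in>U. d (fst p) (snd p) * K z p)"
    using assms(2) unfolding bergman_span_def K_def case_prod_unfold by blast
  \<comment> \<open>The index sets may overlap, so each coefficient is extended by 0 to the union
    before adding.\<close>
  define e where "e = (\<lambda>w \<alpha>. (if (w, \<alpha>) \<in> T then c w \<alpha> else 0) + (if (w, \<alpha>) \<in> U then d w \<alpha> else 0))"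
  have "f z + g z = (\<Sum>p\<in>T \<union> U. e (fst p) (snd p) * K z p)" if "z \<in> \<Omega>" for z
  proof -
    have "f z = (\<Sum>p\<in>T \<union> U. (if p \<in> T then c (fst p) (snd p) else 0) * K z p)"
      unfolding T(3) [rule_format, OF that] by (rule sum.mono_neutral_cong_left) (use T U in auto)
    moreover have "g z = (\<Sum>p\<in>T \<union> U. (if p \<in> U then d (fst p) (snd p) else 0) * K z p)"
      unfolding U(3) [rule_format, OF that] by (rule sum.mono_neutral_cong_left) (use T U in auto)
    ultimately show ?thesis
      by (simp add: e_def sum.distrib ring_distribs)
  qed
  then show ?thesis
    unfolding bergman_span_def case_prod_unfold K_def using T U
    by (intro CollectI exI [of _ "T \<union> U"] exI [of _ e]) auto
qed

lemma bergman_span_zero: "(\<lambda>_. 0) \<in> bergman_span \<Omega>"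
  unfolding bergman_span_def by (intro CollectI exI [of _ "{}"]) auto

lemma bergman_span_sum:
  "(\<And>i. i \<in> I \<Longrightarrow> f i \<in> bergman_span \<Omega>) \<Longrightarrow> (\<lambda>z. \<Sum>i\<in>I. f i z) \<in> bergman_span \<Omega>"
  by (induction I rule: infinite_finite_induct) (auto intro: bergman_span_zero bergman_span_add)

text \<open>With \<open>\<eta>\<close> fixed, the weight \<open>exp (cnj (\<eta> $ 2)) ^ p\<close>
  is a scalar and is absorbed into the coefficient.\<close>

lemma lspan_kernel_pd_bars_bergman_span:
  assumes "f \<in> lspan kernel_pd_bars" and \<eta>: "\<eta> \<in> exp_domain"
  shows "(\<lambda>\<zeta>. f \<zeta> \<eta>) \<in> bergman_span exp_domain"
  using assms(1)
proof induction
  case zero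
  then show ?case by (rule bergman_span_zero)
next
  case (step f g c)
  then obtain p a b where g: "g = (mult_exp_cnj ^^ p) ((dbar 1 ^^ a) ((dbar 2 ^^ b) (exp_kernel_deriv 0 0 0)))"
    unfolding kernel_pd_bars_def by auto
  have pow: "(mult_exp_cnj ^^ n) h \<zeta> \<eta> = exp (cnj (\<eta> $ 2)) ^ n * h \<zeta> \<eta>" for n h \<zeta>
    by (induction n) (simp_all add: mult_exp_cnj_def)
  define \<alpha> :: "2 \<Rightarrow> nat" where "\<alpha> = (\<lambda>i. if i = 1 then a else b)"
  have "(\<lambda>\<zeta>. exp (cnj (\<eta> $ 2)) ^ p * multi_pd pd_bar \<alpha> (bergman_kernel exp_domain \<zeta>) \<eta>) \<in> bergman_span exp_domain"
    by (intro bergman_span_scale bergman_span_kernel \<eta>)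
  then have "(\<lambda>\<zeta>. g \<zeta> \<eta>) \<in> bergman_span exp_domain"
    by (rule bergman_span_cong) (simp add: g pow multi_pd_bar_bergman_kernel \<eta> \<alpha>_def)
  with step show ?case
    by (intro bergman_span_add bergman_span_scale)
qed

section \<open>Polynomials in u belong to the span\<close>

lemma u_monomial_in_bergman_span: "(\<lambda>\<zeta>. u1 \<zeta> ^ a * u2 \<zeta> ^ b) \<in> bergman_span exp_domain"
proof -
  let ?o = "shear_exp (0, 0)"
  have o: "?o \<in> exp_domain"
    by simp
  \<comment> \<open>Since \<open>u1 ?o = 0\<close> and \<open>u2 ?o = 0\<close>, the kernel
    derivative is the monomial times both factorials over \<open>pi\<^sup>2\<close>; the constant
    undoes these.\<close>
  have "(\<lambda>\<zeta>. pi\<^sup>2 / (fact (Suc a) * fact (Suc b)) * exp_kernel_deriv 0 a b \<zeta> ?o) \<in> bergman_span exp_domain"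
    by (intro bergman_span_scale lspan_kernel_pd_bars_bergman_span exp_kernel_deriv_in_lspan_kernel_pd_bars o)
  then show ?thesis
    by (rule bergman_span_cong) (use o in \<open>simp add: exp_kernel_deriv_def disc_kernel_deriv_def del: fact_Suc\<close>)
qed

lemma snd_power_in_bergman_span: "(\<lambda>\<zeta>. \<zeta> $ 2 ^ k) \<in> bergman_span exp_domain"
proof -
  have "(\<lambda>\<zeta>. \<Sum>i\<le>k. of_nat (k choose i) * (u1 \<zeta> ^ i * u2 \<zeta> ^ (k - i))) \<in> bergman_span exp_domain"
    by (intro bergman_span_sum bergman_span_scale u_monomial_in_bergman_span)
  then show ?thesis
  proof (rule bergman_span_cong)
    fix \<zeta> :: "complex ^ 2"
    have "\<zeta> $ 2 = u1 \<zeta> + u2 \<zeta>"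
      by (simp add: u1_def u2_def)
    then show "\<zeta> $ 2 ^ k = (\<Sum>i\<le>k. of_nat (k choose i) * (u1 \<zeta> ^ i * u2 \<zeta> ^ (k - i)))"
      by (simp add: binomial_ring mult.assoc)
  qed
qed

section \<open>Elements of the span on a slice\<close>

text \<open>At \<open>shear_exp (z, 0)\<close> one has \<open>u1 = z\<close> and
  \<open>u2 = 0\<close>, so a generator is a constant times
  \<open>disc_kernel_deriv a z (u1 \<eta>)\<close>, whose denominator has no zero on the
  disc.\<close>

lemma rational_on_lspan_exp_kernel_derivs:
  assumes "f \<in> lspan exp_kernel_derivs" and \<eta>: "\<eta> \<in> exp_domain"
  shows "rational_on (ball 0 1) (\<lambda>z. f (shear_exp (z, 0)) \<eta>)"
  using assms(1)
proof induction
  case zero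
  then show ?case by (rule rational_on_const)
next
  case (step f g c)
  then obtain p a b where g: "g = exp_kernel_deriv p a b"
    by (auto simp: exp_kernel_derivs_def)
  have id: "rational_on (ball 0 1) (\<lambda>z. z)"
    using rational_on_poly [of _ "[:0, 1:]"] rational_on_cong [of "ball 0 1" "poly [:0, 1:]" "\<lambda>z. z"] by simp
  have minus: "rational_on (ball 0 1) (\<lambda>z. 1 - z * cnj (u1 \<eta>))"
    using rational_on_add [OF rational_on_const [of _ 1] rational_on_mult [OF id rational_on_const [of _ "- cnj (u1 \<eta>)"]]]
    by simp
  have nz: "1 - z * cnj (u1 \<eta>) \<noteq> 0" if "z \<in> ball 0 1" for z
    using one_minus_u_nonzero(1) [of "shear_exp (z, 0)" \<eta>] \<eta> that by simp
  have "rational_on (ball 0 1) (\<lambda>z. exp (cnj (\<eta> $ 2)) ^ p * disc_kernel_deriv b 0 (u2 \<eta>) / pi\<^sup>2 * disc_kernel_deriv a z (u1 \<eta>))"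
    unfolding disc_kernel_deriv_def [of a]
    by (intro rational_on_mult rational_on_const rational_on_power rational_on_inverse id minus nz)
  then have "rational_on (ball 0 1) (\<lambda>z. g (shear_exp (z, 0)) \<eta>)"
    by (rule iffD1 [OF rational_on_cong, rotated]) (use \<eta> in \<open>simp add: g exp_kernel_deriv_def mult_ac\<close>)
  with step show ?case
    by (intro rational_on_add rational_on_mult rational_on_const)
qed

lemma rational_on_bergman_span:
  assumes "g \<in> bergman_span exp_domain"
  shows "rational_on (ball 0 1) (\<lambda>z. g (shear_exp (z, 0)))"
proof -
  obtain T c where T: "fst ` T \<subseteq> exp_domain" and
    eq: "\<forall>z\<in>exp_domain. g z = (\<Sum>p\<in>T. c (fst p) (snd p) * multi_pd pd_bar (snd p) (bergman_kernel exp_domain z) (fst p))"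
    using assms unfolding bergman_span_def case_prod_unfold by blast
  define F where "F = (\<lambda>\<alpha> :: 2 \<Rightarrow> nat. (dbar 1 ^^ \<alpha> 1) ((dbar 2 ^^ \<alpha> 2) (exp_kernel_deriv 0 0 0)))"
  have "rational_on (ball 0 1) (\<lambda>z. \<Sum>p\<in>T. c (fst p) (snd p) * F (snd p) (shear_exp (z, 0)) (fst p))"
    using T unfolding F_def
    by (intro rational_on_sum rational_on_mult rational_on_const rational_on_lspan_exp_kernel_derivs
          dbar_pow_lspan_exp_kernel_derivs exp_kernel_deriv_in_lspan) auto
  then show ?thesis
  proof (rule iffD1 [OF rational_on_cong, rotated])
    fix z :: complex assume "z \<in> ball 0 1"
    then have z: "shear_exp (z, 0) \<in> exp_domain" by simp
    then show "(\<Sum>p\<in>T. c (fst p) (snd p) * F (snd p) (shear_exp (z, 0)) (fst p)) = g (shear_exp (z, 0))"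
      unfolding bspec [OF eq z] F_def using T
      by (intro sum.cong) (auto simp: multi_pd_bar_bergman_kernel image_subset_iff)
  qed
qed

lemma fst_power_not_in_bergman_span:
  assumes "k > 0"
  shows "(\<lambda>\<zeta>. \<zeta> $ 1 ^ k) \<notin> bergman_span exp_domain"
  using rational_on_bergman_span not_rational_on_exp_plus_power [OF assms]
  by (fastforce simp: shear_exp_def)

theorem proposition4p2:
  fixes f :: "complex^2 \<Rightarrow> complex^2" and V :: "(complex^2) set"
  assumes "\<And>z. z \<in> unit_polydisc \<Longrightarrow> f z = vector [exp (z $ 1 + z $ 2) + z $ 1, z $ 1 + z $ 2]"
    and "V = f ` unit_polydisc"
  shows "biholomorphism f unit_polydisc V
    \<and> quadrature_domain V
    \<and> (\<forall>k::nat. (\<lambda>\<zeta>. \<zeta> $ 2 ^ k) \<in> bergman_span V)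
    \<and> (\<forall>k::nat. k > 0 \<longrightarrow> (\<lambda>\<zeta>. \<zeta> $ 1 ^ k) \<notin> bergman_span V)"
proof -
  let ?g = "\<lambda>\<zeta>. vector [u1 \<zeta>, u2 \<zeta>] :: complex ^ 2"
  have f: "f z = shear_exp (z $ 1, z $ 2)" if "z \<in> unit_polydisc" for z
    using assms(1) [OF that] by (simp add: shear_exp_def)
  have mem: "shear_exp (z $ 1, z $ 2) \<in> exp_domain \<longleftrightarrow> z \<in> unit_polydisc" for z :: "complex ^ 2"
    by (simp add: unit_polydisc_def forall_2)
  have gf: "?g (f z) = z" if "z \<in> unit_polydisc" for z
    unfolding f [OF that] u_shear_exp by (simp add: vec_eq_iff forall_2)
  have fg: "?g \<zeta> \<in> unit_polydisc" "f (?g \<zeta>) = \<zeta>" if "\<zeta> \<in> exp_domain" for \<zeta>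
  proof -
    show "?g \<zeta> \<in> unit_polydisc"
      using that by (simp add: unit_polydisc_def exp_domain_def forall_2)
    from f [OF this] show "f (?g \<zeta>) = \<zeta>" by simp
  qed
  have bij: "bij_betw f unit_polydisc exp_domain"
    by (rule bij_betw_byWitness [where f' = ?g]) (use gf fg f mem in auto)
  then have V: "V = exp_domain"
    using assms(2) by (simp add: bij_betw_def)
  have inv: "inv_into unit_polydisc f \<zeta> = ?g \<zeta>" if "\<zeta> \<in> exp_domain" for \<zeta>
    using bij fg [OF that] by (intro inv_into_f_eq) (auto simp: bij_betw_def)
  have op: "open (unit_polydisc :: (complex ^ 2) set)"
    unfolding unit_polydisc_def forall_2
    by (intro open_Collect_conj open_Collect_less continuous_intros)
  \<comment> \<open>\<open>f\<close> is prescribed only on the polydisc, and \<open>inv_into\<close>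
    agrees with \<open>?g\<close> only on the image, so holomorphy is transferred by congruence on
    these open sets.\<close>
  have "(\<lambda>z. f z $ i) cn_holomorphic_on unit_polydisc" for i
  proof -
    have "(\<lambda>z. exp (z $ 1 + z $ 2) + z $ 1 :: complex) cn_holomorphic_on (unit_polydisc :: (complex ^ 2) set)"
      "(\<lambda>z. z $ 1 + z $ 2 :: complex) cn_holomorphic_on (unit_polydisc :: (complex ^ 2) set)"
      by (intro cn_holomorphic_intros)+
    then show ?thesis
      using exhaust_2 [of i] by (auto simp: assms(1) cong: cn_holomorphic_on_cong [OF op])
  qed
  moreover have "(\<lambda>w. inv_into unit_polydisc f w $ i) cn_holomorphic_on exp_domain" for i
    using exhaust_2 [of i] u_cn_holomorphic [of exp_domain]
    by (auto simp: inv cong: cn_holomorphic_on_cong [OF open_exp_domain])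
  ultimately have "biholomorphism f unit_polydisc V"
    unfolding biholomorphism_def V using op open_exp_domain bij by blast
  then show ?thesis
    unfolding V using quadrature_domain_exp_domain snd_power_in_bergman_span fst_power_not_in_bergman_span
    by blast
qed

end
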